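(* Let $P_c(\mathbb{R})$ be the set of continuous Borel probability measures on $\mathbb{R}$ and let $\phi\colon P_c(\mathbb{R})\to P_c(\mathbb{R})$ be a surjective map which is an isometry with respect to the Kuiper distance, i.e. $d_{Ku}(\phi(\mu),\phi(\nu))=d_{Ku}(\mu,\nu)$ for all $\mu,\nu\in P_c(\mathbb{R})$. Then there exist a homeomorphism $g\colon\mathbb{R}\to\mathbb{R}$ and an $x\in\mathbb{R}\cup\{\infty\}$ such that $$\phi(\mu)=\mu\circ(g\circ r_x)\qquad(\mu\in P_c(\mathbb{R})).$$ Moreover, every transformation of this form (with $g$ a homeomorphism of $\mathbb{R}$ and $x\in\mathbb{R}\cup\{\infty\}$) is a surjective isometry of $P_c(\mathbb{R})$ with respect to the Kuiper distance.
   Context: A Borel probability measure $\mu$ on $\mathbb{R}$ is continuous if $\mu(\{t\})=0$ for every $t\in\mathbb{R}$. For Borel probability measures $\mu,\nu$ on $\mathbb{R}$ with distribution functions $f_\mu(t)=\mu((-\infty,t])$, the Kuiper distance is $d_{Ku}(\mu,\nu)=\sup_{t}(f_\mu(t)-f_\nu(t))+\sup_t(f_\nu(t)-f_\mu(t))$, which equals $\sup\{|\mu(I)-\nu(I)|: I\subseteq\mathbb{R}\text{ a non-degenerate interval}\}$. For $x\in\mathbb{R}$, $r_x\colon\mathbb{R}\setminus\{x\}\to\mathbb{R}$ is $r_x(t)=1/(t-x)$, and $r_\infty\colon\mathbb{R}\to\mathbb{R}$ is the identity. If $A$ is a Borel set and $G\colon A\to\mathbb{R}$ is injective and maps Borel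 sets to Borel sets, then $\mu\circ G$ denotes the Borel measure $(\mu\circ G)(B)=\mu(G(B\cap A))$ for Borel $B\subseteq\mathbb{R}$. *)

theory Defs
  imports "HOL-Probability.Probability"
begin

definition Pc :: "real measure set" where
  "Pc = {M. prob_space M \<and> sets M = sets borel \<and> (\<forall>t. emeasure M {t} = 0)}"

definition distr_fun :: "real measure \<Rightarrow> real \<Rightarrow> real" where
  "distr_fun M t = measure M {..t}"

definition kuiper :: "real measure \<Rightarrow> real measure \<Rightarrow> real" where
  "kuiper M N = (SUP t. distr_fun M t - distr_fun N t) + (SUP t. distr_fun N t - distr_fun M t)"

text \<open>The maps r_x; the point at infinity is represented by None.\<close>
definition r_dom :: "real option \<Rightarrow> real set" where
  "r_dom x = (case x of None \<Rightarrow> UNIV | Some a \<Rightarrow> - {a})"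

definition r_map :: "real option \<Rightarrow> real \<Rightarrow> real" where
  "r_map x = (case x of None \<Rightarrow> id | Some a \<Rightarrow> (\<lambda>t. 1 / (t - a)))"

definition meas_comp :: "real measure \<Rightarrow> (real \<Rightarrow> real) \<Rightarrow> real set \<Rightarrow> real measure" where
  "meas_comp M G A = measure_of UNIV (sets borel) (\<lambda>B. emeasure M (G ` (B \<inter> A)))"

end

theory Submission
  imports Defs
begin

text \<open>On the circle obtained from the line by adding a point at infinity, the Kuiper distance of two
  continuous measures is the oscillation of the difference of their distribution functions, hence the
  largest value of \<open>\<mu>(A) - \<nu>(A)\<close> over arcs A. It equals 1 iff \<open>\<mu>\<close> and \<open>\<nu>\<close> live on complementary
  arcs. Write \<open>perp X\<close> for the measures at distance 1 from all of X. The sets of the form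
  \<open>perp {\<mu>} = perp (perp {\<nu>})\<close> are exactly the sets of all measures concentrated on some arc, so an
  isometry \<open>\<phi>\<close> permutes these sets. The distance from \<open>\<mu>\<close> to the measures concentrated on A is
  \<open>1 - \<mu>(A)\<close>; hence \<open>\<phi>(\<mu>)(A') = \<mu>(A)\<close> if A' is the arc corresponding to A.

  The arcs corresponding to two half-lines \<open>{..s}\<close> and \<open>{..t}\<close> share exactly one endpoint, because
  their difference is again an arc. Having the same initial point and having the same final point are
  equivalence relations whose union is total, so one of them is total, and all these arcs share an
  endpoint p. Moving p to infinity by \<open>r\<^sub>p\<close>, followed by a reflection if necessary, leads to an
  isometry that sends half-lines \<open>{..t}\<close> to half-lines \<open>{..\<kappa> t}\<close>. Applying the same argument to its
  inverse shows that \<open>\<kappa>\<close> is an increasing bijection.\<close>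

section \<open>The Kuiper distance on the circle\<close>

lemma PcD:
  assumes "M \<in> Pc"
  shows "prob_space M" "sets M = sets borel" "space M = UNIV" "emeasure M {t} = 0" "measure M {t} = 0"
    "real_distribution M"
proof -
  show a: "prob_space M" "sets M = sets borel" "emeasure M {t} = 0"
    using assms by (auto simp: Pc_def)
  show "space M = UNIV" using sets_eq_imp_space_eq[OF a(2)] by simp
  show "measure M {t} = 0" using a(3) by (simp add: measure_def)
  show "real_distribution M" using a(1,2)
    by (simp add: real_distribution_def real_distribution_axioms_def)
qed

lemma distr_fun_eq_cdf: "distr_fun M = cdf M"
  by (auto simp: distr_fun_def cdf_def)

lemma measure_finite_Pc: "M \<in> Pc \<Longrightarrow> finite A \<Longrightarrow> measure M A = 0"
proof -
  assume M: "M \<in> Pc" and "finite A"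
  interpret real_distribution M using PcD(6)[OF M] .
  have "measure M A = (\<Sum>x\<in>A. measure M {x})"
    using \<open>finite A\<close> by (intro measure_eq_sum_singleton) auto
  then show ?thesis using PcD(5)[OF M] by simp
qed

text \<open>Allows preimages and arcs to be compared away from endpoints and from points where a map
  takes a default value.\<close>

lemma measure_eq_upto_finite:
  assumes M: "M \<in> Pc" and "A \<in> sets borel" "B \<in> sets borel" "finite F" "A \<subseteq> B \<union> F" "B \<subseteq> A \<union> F"
  shows "measure M A = measure M B"
proof -
  interpret real_distribution M using PcD(6)[OF M] .
  have F: "F \<in> sets M" using \<open>finite F\<close> by (simp add: borel_closed finite_imp_closed)
  have "measure M X \<le> measure M Y" if "X \<in> sets borel" "Y \<in> sets borel" "X \<subseteq> Y \<union> F" for X Y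
  proof -
    have "measure M X \<le> measure M (Y \<union> F)" using that F by (intro finite_measure_mono) auto
    also have "\<dots> \<le> measure M Y + measure M F" using that F by (intro measure_Un_le) auto
    finally show ?thesis using measure_finite_Pc[OF M \<open>finite F\<close>] by simp
  qed
  from this[of A B] this[of B A] show ?thesis using assms by auto
qed

text \<open>The circle is modelled by \<^typ>\<open>real option\<close>, with \<^const>\<open>None\<close> the point at infinity. The arc
  from p to q is half-open, containing q but not p.\<close>

fun arc :: "real option \<Rightarrow> real option \<Rightarrow> real set" where
  "arc None None = {}"
| "arc None (Some t) = {..t}"
| "arc (Some s) None = {s<..}"
| "arc (Some s) (Some t) = (if s \<le> t then {s<..t} else - {t<..s})"

text \<open>Near infinity a distribution function tends to 0 on one side and to 1 on the other. This
  jump cancels in the difference of two measures in \<open>Pc\<close>, which is therefore continuous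
  on the circle.\<close>

definition circ_cdf :: "real measure \<Rightarrow> real option \<Rightarrow> real" where
  "circ_cdf M p = (case p of None \<Rightarrow> 0 | Some t \<Rightarrow> distr_fun M t)"

lemma arc_measurable [measurable, simp]: "arc p q \<in> sets borel"
  by (cases p; cases q) auto

lemma arc_self [simp]: "arc p p = {}"
  by (cases p) auto

lemma Compl_arc: "p \<noteq> q \<Longrightarrow> - arc p q = arc q p"
  by (cases p; cases q) auto

lemma circ_cdf_None [simp]: "circ_cdf M None = 0"
  and circ_cdf_Some: "circ_cdf M (Some t) = measure M {..t}"
  by (simp_all add: circ_cdf_def distr_fun_def)

lemma measure_Compl_Pc: "M \<in> Pc \<Longrightarrow> A \<in> sets borel \<Longrightarrow> measure M (- A) = 1 - measure M A"
  using prob_space.prob_compl[OF PcD(1), of M A] PcD(2,3)[of M] by (simp add: Compl_eq_Diff_UNIV)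

text \<open>The \<open>of_bool\<close> term records whether the arc contains the point at infinity.
  It does not depend on \<open>M\<close>, so it cancels when two measures are compared.\<close>

lemma measure_arc:
  assumes "M \<in> Pc"
  shows "measure M (arc p q) = circ_cdf M q - circ_cdf M p +
    of_bool (case (p, q) of (None, _) \<Rightarrow> False | (Some s, None) \<Rightarrow> True | (Some s, Some t) \<Rightarrow> t < s)"
proof -
  interpret real_distribution M using PcD(6)[OF assms] .
  have Ioc: "measure M {a<..b} = measure M {..b} - measure M {..a}" if "a \<le> b" for a b
    using cdf_diff_eq[of a b] that by (cases "a = b") (auto simp: cdf_def)
  have Ioi: "measure M {a<..} = 1 - measure M {..a}" for a
    using measure_Compl_Pc[OF assms, of "{..a}"] by (simp add: Compl_atMost)
  show ?thesis
    by (cases p; cases q) (auto simp: circ_cdf_Some Ioc Ioi measure_Compl_Pc[OF assms])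
qed

text \<open>Extended by 0 at infinity, \<open>D\<close> is continuous on a compact circle: its
  maximum is the value at infinity or is attained on a bounded interval outside which
  \<open>D\<close> is smaller.\<close>

lemma SUP_attained_on_circle:
  fixes D :: "real \<Rightarrow> real"
  assumes cont: "continuous_on UNIV D" and lim: "(D \<longlongrightarrow> 0) at_top" "(D \<longlongrightarrow> 0) at_bot"
  shows "\<exists>p. (SUP t. D t) = case_option 0 D p \<and> (\<forall>q. case_option 0 D q \<le> case_option 0 D p)"
proof (cases "\<forall>t. D t \<le> 0")
  case True
  have "(SUP t. D t) = 0"
  proof (rule cSup_eq_non_empty)
    fix y assume y: "\<And>x. x \<in> range D \<Longrightarrow> x \<le> y"
    show "0 \<le> y"
      by (rule tendsto_upperbound[OF lim(1)]) (auto simp: y)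
  qed (use True in auto)
  then show ?thesis using True by (intro exI[of _ None]) (auto split: option.split)
next
  case False
  then obtain t0 where t0: "D t0 > 0" by (auto simp: not_le)
  obtain b where b: "\<And>t. t \<ge> b \<Longrightarrow> D t < D t0"
    using order_tendstoD(2)[OF lim(1) t0] by (auto simp: eventually_at_top_linorder)
  obtain a where a: "\<And>t. t \<le> a \<Longrightarrow> D t < D t0"
    using order_tendstoD(2)[OF lim(2) t0] by (auto simp: eventually_at_bot_linorder)
  have ab: "a < t0" "t0 < b" using a[of t0] b[of t0] by force+
  obtain m where m: "m \<in> {a..b}" "\<And>t. t \<in> {a..b} \<Longrightarrow> D t \<le> D m"
  proof -
    have "\<exists>x\<in>{a..b}. \<forall>y\<in>{a..b}. D y \<le> D x"
      by (rule continuous_attains_sup) (use ab continuous_on_subset[OF cont] in auto)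
    then show thesis using that by auto
  qed
  have mt0: "D t0 \<le> D m" using m(2)[of t0] ab by auto
  have max: "D t \<le> D m" for t
    using m(2)[of t] a[of t] b[of t] mt0 by (cases "t < a"; cases "t > b") auto
  have "(SUP t. D t) = D m" by (rule cSup_eq_maximum) (auto simp: max)
  moreover have "0 \<le> D m" using t0 mt0 by linarith
  ultimately show ?thesis using max by (intro exI[of _ "Some m"]) (auto split: option.split)
qed

text \<open>The two suprema in \<open>kuiper\<close> are the maxima on the circle of the difference
  of distribution functions and of its negative, so their sum is maximum minus minimum.\<close>

lemma kuiper_attained:
  assumes M: "M \<in> Pc" and N: "N \<in> Pc"
  shows "\<exists>p q. kuiper M N = (circ_cdf M q - circ_cdf N q) - (circ_cdf M p - circ_cdf N p) \<and>
    (\<forall>p q. (circ_cdf M q - circ_cdf N q) - (circ_cdf M p - circ_cdf N p) \<le> kuiper M N)"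
proof -
  have D: "continuous_on UNIV (\<lambda>t. distr_fun M t - distr_fun N t)"
    "((\<lambda>t. distr_fun M t - distr_fun N t) \<longlongrightarrow> 0) at_top"
    "((\<lambda>t. distr_fun M t - distr_fun N t) \<longlongrightarrow> 0) at_bot"
    if M: "M \<in> Pc" and N: "N \<in> Pc" for M N
  proof -
    interpret M: real_distribution M using PcD(6)[OF M] .
    interpret N: real_distribution N using PcD(6)[OF N] .
    show "continuous_on UNIV (\<lambda>t. distr_fun M t - distr_fun N t)"
      using M.isCont_cdf N.isCont_cdf PcD(5)[OF M] PcD(5)[OF N]
      by (auto simp: distr_fun_eq_cdf intro!: continuous_on_diff continuous_at_imp_continuous_on)
    show "((\<lambda>t. distr_fun M t - distr_fun N t) \<longlongrightarrow> 0) at_top"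
      using tendsto_diff[OF M.cdf_lim_at_top_prob N.cdf_lim_at_top_prob] by (simp add: distr_fun_eq_cdf)
    show "((\<lambda>t. distr_fun M t - distr_fun N t) \<longlongrightarrow> 0) at_bot"
      using tendsto_diff[OF M.cdf_lim_at_bot N.cdf_lim_at_bot] by (simp add: distr_fun_eq_cdf)
  qed
  have c: "case_option 0 (\<lambda>t. distr_fun A t - distr_fun B t) p = circ_cdf A p - circ_cdf B p" for A B p
    by (simp add: circ_cdf_def split: option.split)
  obtain q where q: "(SUP t. distr_fun M t - distr_fun N t) = circ_cdf M q - circ_cdf N q"
     "\<And>r. circ_cdf M r - circ_cdf N r \<le> circ_cdf M q - circ_cdf N q"
    using SUP_attained_on_circle[OF D[OF M N]] unfolding c by auto
  obtain p where p: "(SUP t. distr_fun N t - distr_fun M t) = circ_cdf N p - circ_cdf M p"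
     "\<And>r. circ_cdf N r - circ_cdf M r \<le> circ_cdf N p - circ_cdf M p"
    using SUP_attained_on_circle[OF D[OF N M]] unfolding c by auto
  have "u - v - (w - x) \<le> (y - z) + (a - b)" if "u - v \<le> y - z" "x - w \<le> a - b" for u v w x y z a b :: real
    using that by linarith
  note arith = this
  have k: "kuiper M N = (circ_cdf M q - circ_cdf N q) + (circ_cdf N p - circ_cdf M p)"
    unfolding kuiper_def q(1) p(1) ..
  show ?thesis
  proof (rule exI[of _ p], rule exI[of _ q], intro conjI allI)
    show "kuiper M N = (circ_cdf M q - circ_cdf N q) - (circ_cdf M p - circ_cdf N p)"
      using k by simp
    show "(circ_cdf M b - circ_cdf N b) - (circ_cdf M a - circ_cdf N a) \<le> kuiper M N" for a b
      unfolding k by (rule arith[OF q(2) p(2)])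
  qed
qed

lemma kuiper_ge_circ_cdf:
  "M \<in> Pc \<Longrightarrow> N \<in> Pc \<Longrightarrow>
    (circ_cdf M q - circ_cdf N q) - (circ_cdf M p - circ_cdf N p) \<le> kuiper M N"
  using kuiper_attained by blast

lemma kuiper_ge_arc:
  "M \<in> Pc \<Longrightarrow> N \<in> Pc \<Longrightarrow> measure M (arc p q) - measure N (arc p q) \<le> kuiper M N"
  using kuiper_ge_circ_cdf[of M N q p] by (simp add: measure_arc)

lemma kuiper_attained_arc:
  assumes M: "M \<in> Pc" and N: "N \<in> Pc"
  shows "\<exists>p q. kuiper M N = measure M (arc p q) - measure N (arc p q)"
proof -
  obtain p q where "kuiper M N = (circ_cdf M q - circ_cdf N q) - (circ_cdf M p - circ_cdf N p)"
    using kuiper_attained[OF assms] by blast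
  then have "kuiper M N = measure M (arc p q) - measure N (arc p q)"
    by (simp add: measure_arc[OF M] measure_arc[OF N])
  then show ?thesis by blast
qed

lemma kuiper_commute: "kuiper M N = kuiper N M"
  by (simp add: kuiper_def)

lemma Pc_eqI:
  assumes "M \<in> Pc" "N \<in> Pc" "\<And>t. measure M {..t} = measure N {..t}"
  shows "M = N"
  using cdf_unique[OF PcD(6)[OF assms(1)] PcD(6)[OF assms(2)]] assms(3) by (auto simp: cdf_def fun_eq_iff)

lemma kuiper_eq_0_iff:
  assumes M: "M \<in> Pc" and N: "N \<in> Pc"
  shows "kuiper M N = 0 \<longleftrightarrow> M = N"
proof
  assume 0: "kuiper M N = 0"
  show "M = N"
  proof (rule Pc_eqI[OF M N])
    fix t
    show "measure M {..t} = measure N {..t}"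
      using kuiper_ge_circ_cdf[OF M N, of "Some t" None] kuiper_ge_circ_cdf[OF M N, of None "Some t"] 0
      by (simp add: circ_cdf_Some)
  qed
qed (simp add: kuiper_def)

section \<open>Measures concentrated on arcs\<close>

lemma inj_on_kuiper: "inj_on \<phi> Pc"
  if "\<And>\<mu> \<nu>. \<mu> \<in> Pc \<Longrightarrow> \<nu> \<in> Pc \<Longrightarrow> kuiper (\<phi> \<mu>) (\<phi> \<nu>) = kuiper \<mu> \<nu>" "\<phi> ` Pc \<subseteq> Pc"
proof (rule inj_onI)
  fix \<mu> \<nu> assume *: "\<mu> \<in> Pc" "\<nu> \<in> Pc" "\<phi> \<mu> = \<phi> \<nu>"
  then have "kuiper (\<phi> \<mu>) (\<phi> \<nu>) = 0" using that(2) kuiper_eq_0_iff by blast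
  then show "\<mu> = \<nu>" using that(1)[OF *(1,2)] kuiper_eq_0_iff[OF *(1,2)] by simp
qed

definition kuiper_isometry :: "(real measure \<Rightarrow> real measure) \<Rightarrow> bool" where
  "kuiper_isometry \<phi> \<longleftrightarrow> \<phi> ` Pc = Pc \<and> (\<forall>\<mu>\<in>Pc. \<forall>\<nu>\<in>Pc. kuiper (\<phi> \<mu>) (\<phi> \<nu>) = kuiper \<mu> \<nu>)"

lemma kuiper_isometryD:
  assumes "kuiper_isometry \<phi>"
  shows "\<phi> ` Pc = Pc" "\<mu> \<in> Pc \<Longrightarrow> \<phi> \<mu> \<in> Pc" "bij_betw \<phi> Pc Pc"
    "\<mu> \<in> Pc \<Longrightarrow> \<nu> \<in> Pc \<Longrightarrow> kuiper (\<phi> \<mu>) (\<phi> \<nu>) = kuiper \<mu> \<nu>"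
proof -
  show 1: "\<phi> ` Pc = Pc" and 2: "\<mu> \<in> Pc \<Longrightarrow> \<nu> \<in> Pc \<Longrightarrow> kuiper (\<phi> \<mu>) (\<phi> \<nu>) = kuiper \<mu> \<nu>" for \<mu> \<nu>
    using assms unfolding kuiper_isometry_def by blast+
  show "\<mu> \<in> Pc \<Longrightarrow> \<phi> \<mu> \<in> Pc" using 1 by blast
  show "bij_betw \<phi> Pc Pc" unfolding bij_betw_def using inj_on_kuiper[OF 2] 1 by simp
qed

lemma kuiper_isometry_comp:
  "kuiper_isometry \<phi> \<Longrightarrow> kuiper_isometry \<psi> \<Longrightarrow> kuiper_isometry (\<psi> \<circ> \<phi>)"
proof -
  assume \<phi>: "kuiper_isometry \<phi>" and \<psi>: "kuiper_isometry \<psi>"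
  have "(\<psi> \<circ> \<phi>) ` Pc = Pc"
    unfolding image_comp[symmetric] kuiper_isometryD(1)[OF \<phi>] by (rule kuiper_isometryD(1)[OF \<psi>])
  then show ?thesis
    using kuiper_isometryD(2,4)[OF \<phi>] kuiper_isometryD(4)[OF \<psi>] by (simp add: kuiper_isometry_def)
qed

lemma kuiper_isometry_inv:
  assumes "kuiper_isometry \<phi>"
  shows "kuiper_isometry (inv_into Pc \<phi>)"
  unfolding kuiper_isometry_def
proof (intro conjI ballI)
  note b = kuiper_isometryD[OF assms]
  show "inv_into Pc \<phi> ` Pc = Pc" using bij_betw_inv_into[OF b(3)] by (simp add: bij_betw_def)
  fix \<mu> \<nu> assume "\<mu> \<in> Pc" "\<nu> \<in> Pc"
  then show "kuiper (inv_into Pc \<phi> \<mu>) (inv_into Pc \<phi> \<nu>) = kuiper \<mu> \<nu>"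
    using b(1) b(4)[of "inv_into Pc \<phi> \<mu>" "inv_into Pc \<phi> \<nu>"] by (simp add: inv_into_into f_inv_into_f)
qed

text \<open>Arcs are finite unions of intervals that are open on the left and closed on the right;
  for such sets no null set gets in the way.\<close>

lemma arc_left_locally_constant: "\<exists>e>0. \<forall>y\<in>{x - e<..x}. y \<in> arc p q \<longleftrightarrow> x \<in> arc p q"
proof -
  have *: "\<exists>e>0. \<forall>y\<in>{x - e<..x}. y \<le> t \<longleftrightarrow> x \<le> t" for t
    by (intro exI[of _ "if x \<le> t then 1 else x - t"]) auto
  obtain d where d: "d > 0" "\<forall>y\<in>{x - d<..x}. y \<le> the p \<longleftrightarrow> x \<le> the p"
    using *[of "the p"] by auto
  obtain e where e: "e > 0" "\<forall>y\<in>{x - e<..x}. y \<le> the q \<longleftrightarrow> x \<le> the q"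
    using *[of "the q"] by auto
  have "y \<in> arc p q \<longleftrightarrow> x \<in> arc p q" if "y \<in> {x - min d e<..x}" for y
  proof -
    have "y \<le> the p \<longleftrightarrow> x \<le> the p" "y \<le> the q \<longleftrightarrow> x \<le> the q"
      using that by (auto intro!: bspec[OF d(2)] bspec[OF e(2)])
    moreover from this have "the p < y \<longleftrightarrow> the p < x" "the q < y \<longleftrightarrow> the q < x" by auto
    ultimately show ?thesis by (cases p; cases q) simp_all
  qed
  moreover have "min d e > 0" using d(1) e(1) by simp
  ultimately show ?thesis by blast
qed

section \<open>Measures charging every arc that meets a given arc\<close>

abbreviation gauss :: "real measure" where
  "gauss \<equiv> density lborel std_normal_density"

text \<open>The density is positive everywhere.\<close>

lemma gauss_null_sets_iff: "A \<in> sets borel \<Longrightarrow> emeasure gauss A = 0 \<longleftrightarrow> emeasure lborel A = 0"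
proof -
  assume A: "A \<in> sets borel"
  have "emeasure gauss A = 0 \<longleftrightarrow> A \<in> null_sets gauss" using A by auto
  also have "\<dots> \<longleftrightarrow> (AE x in lborel. x \<notin> A)"
  proof -
    have "\<not> std_normal_density x \<le> 0" for x using normal_density_pos[of 1 0 x] by (simp add: not_le)
    then show ?thesis using A by (subst null_sets_density_iff) (auto simp: ennreal_eq_0_iff)
  qed
  also have "\<dots> \<longleftrightarrow> emeasure lborel A = 0"
    using A by (subst AE_iff_null_sets[symmetric]) auto
  finally show ?thesis .
qed

lemma gauss_Pc: "gauss \<in> Pc"
  using gauss_null_sets_iff by (auto simp: Pc_def intro: prob_space_normal_density)

lemma uniform_measure_Pc:
  assumes "M \<in> Pc" "A \<in> sets borel" "measure M A > 0"
  shows "uniform_measure M A \<in> Pc" "measure (uniform_measure M A) A = 1"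
proof -
  interpret real_distribution M using PcD(6)[OF assms(1)] .
  have e: "emeasure M A \<noteq> 0" using assms(3) by (auto simp: measure_def)
  show "measure (uniform_measure M A) A = 1" using e assms by simp
  have "emeasure (uniform_measure M A) {t} = 0" for t
  proof -
    have "emeasure M (A \<inter> {t}) \<le> emeasure M {t}" by (intro emeasure_mono) auto
    then have "emeasure M (A \<inter> {t}) = 0" using PcD(4)[OF assms(1)] by simp
    then show ?thesis using assms e by simp
  qed
  then show "uniform_measure M A \<in> Pc"
    using e assms PcD(2)[OF assms(1)] by (auto simp: Pc_def intro!: prob_space_uniform_measure)
qed

text \<open>To the left of a common point, a short interval of positive length stays inside both
  arcs.\<close>

lemma gauss_Int_arc_pos: "arc p q \<inter> arc p' q' \<noteq> {} \<Longrightarrow> emeasure gauss (arc p q \<inter> arc p' q') \<noteq> 0"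
proof -
  assume "arc p q \<inter> arc p' q' \<noteq> {}"
  then obtain x where x: "x \<in> arc p q" "x \<in> arc p' q'" by auto
  obtain d where d: "d > 0" "\<forall>y\<in>{x - d<..x}. y \<in> arc p q \<longleftrightarrow> x \<in> arc p q"
    using arc_left_locally_constant by blast
  obtain e where e: "e > 0" "\<forall>y\<in>{x - e<..x}. y \<in> arc p' q' \<longleftrightarrow> x \<in> arc p' q'"
    using arc_left_locally_constant by blast
  have "{x - min d e<..x} \<subseteq> arc p q \<inter> arc p' q'" using d e x by auto
  then have "emeasure lborel {x - min d e<..x} \<le> emeasure lborel (arc p q \<inter> arc p' q')"
    by (intro emeasure_mono) auto
  moreover have "emeasure lborel {x - min d e<..x} > 0" using d e by simp
  ultimately show ?thesis by (subst gauss_null_sets_iff) auto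
qed

lemma arc_nonempty: "p \<noteq> q \<Longrightarrow> arc p q \<noteq> {}"
proof -
  assume "p \<noteq> q"
  moreover have "{a<..} \<noteq> {}" for a :: real using gt_ex[of a] by auto
  moreover have "a + 1 \<notin> {t<..a}" for a t :: real by simp
  then have "- {t<..a} \<noteq> {}" for a t :: real by blast
  ultimately show ?thesis
    by (cases p; cases q) auto
qed

text \<open>The Gaussian conditioned on the arc works. Its null arcs miss \<open>arc p q\<close>
  outright, not merely up to a null set.\<close>

lemma full_measure_on_arc:
  assumes "p \<noteq> q"
  shows "\<exists>M\<in>Pc. measure M (arc p q) = 1 \<and>
    (\<forall>p' q'. measure M (arc p' q') = 0 \<longrightarrow> arc p q \<inter> arc p' q' = {})"
proof -
  interpret real_distribution gauss using PcD(6)[OF gauss_Pc] .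
  have e: "emeasure gauss (arc p q) \<noteq> 0"
    using gauss_Int_arc_pos[of p q p q] arc_nonempty[OF assms] by simp
  then have pos: "measure gauss (arc p q) > 0"
    by (simp add: emeasure_eq_measure zero_less_measure_iff)
  show ?thesis
  proof (intro bexI conjI allI impI)
    show "uniform_measure gauss (arc p q) \<in> Pc" "measure (uniform_measure gauss (arc p q)) (arc p q) = 1"
      using uniform_measure_Pc[OF gauss_Pc _ pos] by auto
    fix p' q' assume "measure (uniform_measure gauss (arc p q)) (arc p' q') = 0"
    then have "measure gauss (arc p q \<inter> arc p' q') = 0" using e pos by simp
    then show "arc p q \<inter> arc p' q' = {}"
      using gauss_Int_arc_pos[of p q p' q'] by (auto simp: emeasure_eq_measure)
  qed
qed

section \<open>Metric characterisation of the sets of measures concentrated on arcs\<close>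

definition concentrated :: "real option \<Rightarrow> real option \<Rightarrow> real measure set" where
  "concentrated p q = {\<mu> \<in> Pc. measure \<mu> (arc p q) = 1}"

definition perp :: "real measure set \<Rightarrow> real measure set" where
  "perp X = {\<nu> \<in> Pc. \<forall>\<mu>\<in>X. kuiper \<mu> \<nu> = 1}"

text \<open>The distance is attained on some arc, so the value 1 forces mass 1 for \<open>M\<close>
  and mass 0 for \<open>N\<close> there.\<close>

lemma kuiper_eq_1_iff:
  assumes M: "M \<in> Pc" and N: "N \<in> Pc"
  shows "kuiper M N = 1 \<longleftrightarrow> (\<exists>p q. p \<noteq> q \<and> M \<in> concentrated p q \<and> N \<in> concentrated q p)"
proof -
  have le: "measure M A \<le> 1" "measure N A \<le> 1" "measure M A \<ge> 0" "measure N A \<ge> 0" for A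
    using PcD(1)[OF M] PcD(1)[OF N] by (auto simp: prob_space.prob_le_1)
  have compl: "N \<in> concentrated q p \<longleftrightarrow> measure N (arc p q) = 0" if "p \<noteq> q" for p q
    using measure_Compl_Pc[OF N, of "arc p q"] Compl_arc[OF that] N by (simp add: concentrated_def)
  show ?thesis
  proof
    assume k: "kuiper M N = 1"
    obtain p q where pq: "kuiper M N = measure M (arc p q) - measure N (arc p q)"
      using kuiper_attained_arc[OF M N] by blast
    then have "measure M (arc p q) = 1" "measure N (arc p q) = 0"
      using k le(1)[of "arc p q"] le(4)[of "arc p q"] by linarith+
    moreover from this have "p \<noteq> q" by auto
    ultimately show "\<exists>p q. p \<noteq> q \<and> M \<in> concentrated p q \<and> N \<in> concentrated q p"
      using compl M by (auto simp: concentrated_def)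
  next
    assume "\<exists>p q. p \<noteq> q \<and> M \<in> concentrated p q \<and> N \<in> concentrated q p"
    then obtain p q where "p \<noteq> q" "measure M (arc p q) = 1" "measure N (arc p q) = 0"
      using compl by (auto simp: concentrated_def)
    then have "1 \<le> kuiper M N" using kuiper_ge_arc[OF M N, of p q] by simp
    moreover have "kuiper M N \<le> 1"
    proof -
      obtain p q where "kuiper M N = measure M (arc p q) - measure N (arc p q)"
        using kuiper_attained_arc[OF M N] by blast
      then show ?thesis using le(1)[of "arc p q"] le(4)[of "arc p q"] by linarith
    qed
    ultimately show "kuiper M N = 1" by simp
  qed
qed

lemma concentrated_mono: "arc p q \<subseteq> arc p' q' \<Longrightarrow> concentrated p q \<subseteq> concentrated p' q'"
proof
  fix M assume "arc p q \<subseteq> arc p' q'" "M \<in> concentrated p q"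
  then have M: "M \<in> Pc" "measure M (arc p q) = 1" by (auto simp: concentrated_def)
  interpret real_distribution M using PcD(6)[OF M(1)] .
  have "measure M (arc p q) \<le> measure M (arc p' q')"
    by (intro finite_measure_mono) (auto simp: \<open>arc p q \<subseteq> arc p' q'\<close>)
  then show "M \<in> concentrated p' q'" using M prob_le_1[of "arc p' q'"] by (auto simp: concentrated_def)
qed

text \<open>If \<open>S\<close> charges every arc that meets \<open>arc p q\<close>, the complement
  of any arc carrying \<open>S\<close> misses \<open>arc p q\<close> and hence lies in
  \<open>arc q p\<close>.\<close>

lemma perp_full_measure:
  assumes "p \<noteq> q"
  shows "\<exists>S\<in>concentrated p q. perp {S} = concentrated q p"
proof -
  obtain S where S: "S \<in> Pc" "measure S (arc p q) = 1"
    "\<And>p' q'. measure S (arc p' q') = 0 \<Longrightarrow> arc p q \<inter> arc p' q' = {}"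
    using full_measure_on_arc[OF assms] by blast
  have "\<nu> \<in> concentrated q p" if nu: "\<nu> \<in> Pc" "kuiper S \<nu> = 1" for \<nu>
  proof -
    obtain p' q' where pq: "p' \<noteq> q'" "S \<in> concentrated p' q'" "\<nu> \<in> concentrated q' p'"
      using nu kuiper_eq_1_iff[OF S(1) nu(1)] by blast
    then have "measure S (arc q' p') = 0"
      using measure_Compl_Pc[OF S(1), of "arc p' q'"] Compl_arc[OF pq(1)] by (simp add: concentrated_def)
    then have "arc q' p' \<subseteq> arc q p" using S(3) Compl_arc[OF assms] by blast
    then show ?thesis using pq concentrated_mono by blast
  qed
  moreover have "kuiper S \<nu> = 1" "\<nu> \<in> Pc" if "\<nu> \<in> concentrated q p" for \<nu>
    using that kuiper_eq_1_iff[OF S(1), of \<nu>] assms S by (auto simp: concentrated_def)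
  ultimately have "perp {S} = concentrated q p" by (intro equalityI subsetI) (simp_all add: perp_def)
  then show ?thesis using S(1,2) by (intro bexI[of _ S]) (auto simp: concentrated_def)
qed

lemma perp_antimono: "X \<subseteq> Y \<Longrightarrow> perp Y \<subseteq> perp X"
  by (auto simp: perp_def)

lemma perp_concentrated:
  assumes "p \<noteq> q"
  shows "perp (concentrated p q) = concentrated q p"
proof
  show "perp (concentrated p q) \<subseteq> concentrated q p"
  proof -
    obtain S where "S \<in> concentrated p q" "perp {S} = concentrated q p"
      using perp_full_measure[OF assms] by blast
    then show ?thesis using perp_antimono[of "{S}" "concentrated p q"] by simp
  qed
  show "concentrated q p \<subseteq> perp (concentrated p q)"
  proof
    fix \<nu> assume \<nu>: "\<nu> \<in> concentrated q p"
    have "kuiper \<mu> \<nu> = 1" if "\<mu> \<in> concentrated p q" for \<mu>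
      using kuiper_eq_1_iff[of \<mu> \<nu>] that \<nu> assms by (auto simp: concentrated_def)
    then show "\<nu> \<in> perp (concentrated p q)" using \<nu> by (auto simp: perp_def concentrated_def)
  qed
qed

text \<open>The right-hand side speaks of distances only, so isometries preserve it.\<close>

lemma concentrated_characterization:
  "(\<exists>p q. p \<noteq> q \<and> X = concentrated p q) \<longleftrightarrow>
   (\<exists>\<mu>\<in>Pc. \<exists>\<nu>\<in>Pc. X = perp {\<mu>} \<and> X = perp (perp {\<nu>}))"
proof
  assume "\<exists>p q. p \<noteq> q \<and> X = concentrated p q"
  then obtain p q where pq: "p \<noteq> q" "X = concentrated p q" by blast
  obtain \<mu> where "\<mu> \<in> concentrated q p" "perp {\<mu>} = X" using perp_full_measure[of q p] pq by auto
  moreover obtain \<nu> where "\<nu> \<in> concentrated p q" "perp {\<nu>} = concentrated q p"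
    using perp_full_measure[of p q] pq by auto
  moreover have "perp (concentrated q p) = X" using perp_concentrated[of q p] pq by simp
  moreover have "concentrated a b \<subseteq> Pc" for a b by (auto simp: concentrated_def)
  ultimately show "\<exists>\<mu>\<in>Pc. \<exists>\<nu>\<in>Pc. X = perp {\<mu>} \<and> X = perp (perp {\<nu>})"
    by (metis subsetD)
next
  assume "\<exists>\<mu>\<in>Pc. \<exists>\<nu>\<in>Pc. X = perp {\<mu>} \<and> X = perp (perp {\<nu>})"
  then obtain \<mu> \<nu> where mn: "\<mu> \<in> Pc" "\<nu> \<in> Pc" "X = perp {\<mu>}" "X = perp (perp {\<nu>})" by blast
  \<comment> \<open>Every measure lies in its double \<open>perp\<close>, by symmetry of the
    distance.\<close>
  have "\<nu> \<in> X" using mn by (auto simp: perp_def kuiper_commute)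
  then have "kuiper \<mu> \<nu> = 1" using mn by (auto simp: perp_def)
  then obtain p q where pq: "p \<noteq> q" "\<mu> \<in> concentrated p q" "\<nu> \<in> concentrated q p"
    using kuiper_eq_1_iff mn by blast
  \<comment> \<open>Since \<open>perp\<close> is antitone and exchanges the two
    \<open>concentrated\<close> sets, the position of \<nu> bounds \<open>X\<close> from above and
    that of \<mu> bounds it from below.\<close>
  have "concentrated p q \<subseteq> perp {\<nu>}"
    using perp_concentrated[of q p] perp_antimono[of "{\<nu>}"] pq by blast
  then have "X \<subseteq> concentrated q p"
    using perp_concentrated[of p q] perp_antimono pq mn(4) by blast
  moreover have "concentrated q p \<subseteq> X"
    using perp_concentrated[of p q] perp_antimono[of "{\<mu>}"] pq mn(3) by blast
  ultimately have "X = concentrated q p" by (rule antisym)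
  then show "\<exists>p q. p \<noteq> q \<and> X = concentrated p q" using pq(1) by (intro exI[of _ q] exI[of _ p]) simp
qed

lemma perp_image:
  assumes "kuiper_isometry \<phi>" "X \<subseteq> Pc"
  shows "perp (\<phi> ` X) = \<phi> ` perp X"
proof -
  note b = kuiper_isometryD[OF assms(1)]
  show ?thesis
  proof (intro equalityI subsetI)
    fix \<nu> assume \<nu>: "\<nu> \<in> perp (\<phi> ` X)"
    then obtain \<nu>' where "\<nu> = \<phi> \<nu>'" "\<nu>' \<in> Pc" using b(1) by (auto simp: perp_def)
    moreover have "kuiper \<mu> \<nu>' = 1" if "\<mu> \<in> X" for \<mu>
      using \<nu> that assms(2) b(4)[of \<mu> \<nu>'] calculation by (auto simp: perp_def)
    then have "\<nu>' \<in> perp X" using calculation by (simp add: perp_def)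
    ultimately show "\<nu> \<in> \<phi> ` perp X" by simp
  next
    fix \<nu> assume "\<nu> \<in> \<phi> ` perp X"
    then obtain \<nu>' where \<nu>': "\<nu> = \<phi> \<nu>'" "\<nu>' \<in> Pc" "\<And>\<mu>. \<mu> \<in> X \<Longrightarrow> kuiper \<mu> \<nu>' = 1"
      by (auto simp: perp_def)
    have "kuiper (\<phi> \<mu>) \<nu> = 1" if "\<mu> \<in> X" for \<mu>
      using \<nu>' that assms(2) b(4)[of \<mu> \<nu>'] by auto
    then show "\<nu> \<in> perp (\<phi> ` X)" using \<nu>'(1) b(2)[OF \<nu>'(2)] by (auto simp: perp_def)
  qed
qed

lemma image_concentrated:
  assumes "kuiper_isometry \<phi>" "p \<noteq> q"
  shows "\<exists>p' q'. p' \<noteq> q' \<and> \<phi> ` concentrated p q = concentrated p' q'"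
proof -
  obtain \<mu> \<nu> where mn: "\<mu> \<in> Pc" "\<nu> \<in> Pc" "concentrated p q = perp {\<mu>}" "concentrated p q = perp (perp {\<nu>})"
  proof -
    have "\<exists>a b. a \<noteq> b \<and> concentrated p q = concentrated a b" using assms(2) by auto
    then show thesis using that unfolding concentrated_characterization by (elim bexE conjE)
  qed
  have 1: "\<phi> ` concentrated p q = perp {\<phi> \<mu>}"
    using perp_image[OF assms(1), of "{\<mu>}"] mn by simp
  have "perp {\<nu>} \<subseteq> Pc" by (auto simp: perp_def)
  then have 2: "\<phi> ` concentrated p q = perp (perp {\<phi> \<nu>})"
    unfolding mn(4) using perp_image[OF assms(1), of "{\<nu>}"] perp_image[OF assms(1), of "perp {\<nu>}"] mn by simp
  have "\<phi> \<mu> \<in> Pc" "\<phi> \<nu> \<in> Pc" using mn kuiper_isometryD(2)[OF assms(1)] by auto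
  then have "\<exists>\<mu>\<in>Pc. \<exists>\<nu>\<in>Pc. \<phi> ` concentrated p q = perp {\<mu>} \<and> \<phi> ` concentrated p q = perp (perp {\<nu>})"
    using 1 2 by (intro bexI[of _ "\<phi> \<mu>"] bexI[of _ "\<phi> \<nu>"] conjI)
  then have "\<exists>p' q'. p' \<noteq> q' \<and> \<phi> ` concentrated p q = concentrated p' q'"
    by (simp only: concentrated_characterization[of "\<phi> ` concentrated p q"])
  then show ?thesis .
qed

text \<open>The distance from a measure to the measures concentrated on an arc A is its mass off A; a
  nearest point is the measure conditioned on A.\<close>

lemma concentrated_nearest:
  assumes M: "M \<in> Pc" and "p \<noteq> q"
  shows "\<exists>N\<in>concentrated p q. kuiper M N \<le> 1 - measure M (arc p q)"
proof (cases "measure M (arc p q) = 0")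
  \<comment> \<open>Conditioning on a null arc is impossible, but the bound is then 1, which every
    distance satisfies.\<close>
  case True
  obtain N where N: "N \<in> concentrated p q" using perp_full_measure[OF assms(2)] by blast
  then have NP: "N \<in> Pc" by (simp add: concentrated_def)
  obtain a b where "kuiper M N = measure M (arc a b) - measure N (arc a b)"
    using kuiper_attained_arc[OF M NP] by blast
  moreover have "measure M (arc a b) \<le> 1" using PcD(1)[OF M] by (simp add: prob_space.prob_le_1)
  moreover have "measure N (arc a b) \<ge> 0" by simp
  ultimately have "kuiper M N \<le> 1" by linarith
  then show ?thesis using True N by auto
next
  case False
  let ?A = "arc p q" let ?N = "uniform_measure M ?A"
  interpret real_distribution M using PcD(6)[OF M] .
  have pos: "measure M ?A > 0" using False by (simp add: zero_less_measure_iff)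
  have e: "emeasure M ?A \<noteq> 0" using pos by (auto simp: measure_def)
  have N: "?N \<in> Pc" "measure ?N ?A = 1" using uniform_measure_Pc[OF M _ pos] by auto
  obtain a b where ab: "kuiper M ?N = kuiper ?N M" "kuiper ?N M = measure ?N (arc a b) - measure M (arc a b)"
    using kuiper_attained_arc[OF N(1) M] kuiper_commute by blast
  let ?m = "measure M (?A \<inter> arc a b)"
  have "measure ?N (arc a b) = ?m / measure M ?A" using e pos by simp
  moreover have "?m \<le> measure M (arc a b)" by (intro finite_measure_mono) auto
  \<comment> \<open>The left side is nondecreasing in \<open>?m\<close>, and at its largest possible
    value \<open>?m = measure M ?A\<close> it equals the right side.\<close>
  moreover have "?m / measure M ?A - ?m \<le> 1 - measure M ?A"
  proof -
    have "?m \<le> measure M ?A" by (intro finite_measure_mono) auto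
    then have "?m * (1 - measure M ?A) \<le> measure M ?A * (1 - measure M ?A)"
      by (intro mult_right_mono) auto
    then show ?thesis using pos by (simp add: field_simps)
  qed
  ultimately have "kuiper M ?N \<le> 1 - measure M ?A" using ab by linarith
  then show ?thesis using N by (auto simp: concentrated_def)
qed

lemma kuiper_ge_concentrated:
  assumes "M \<in> Pc" "N \<in> concentrated p q"
  shows "1 - measure M (arc p q) \<le> kuiper M N"
  using kuiper_ge_arc[of N M p q] assms unfolding kuiper_commute[of N M] by (simp add: concentrated_def)

text \<open>Masses of arcs are read off from distances to \<open>concentrated\<close> sets, which
  \<phi> permutes. Carrying a nearest measure forward gives one inequality, pulling one back gives
  the other.\<close>

lemma isometry_arc:
  assumes iso: "kuiper_isometry \<phi>" and "p \<noteq> q"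
  shows "\<exists>p' q'. p' \<noteq> q' \<and> (\<forall>\<mu>\<in>Pc. measure (\<phi> \<mu>) (arc p' q') = measure \<mu> (arc p q))"
proof -
  note b = kuiper_isometryD[OF iso]
  obtain p' q' where pq: "p' \<noteq> q'" "\<phi> ` concentrated p q = concentrated p' q'"
    using image_concentrated[OF assms] by blast
  have "measure (\<phi> \<mu>) (arc p' q') = measure \<mu> (arc p q)" if \<mu>: "\<mu> \<in> Pc" for \<mu>
  proof (rule antisym)
    obtain N where N: "N \<in> concentrated p q" "kuiper \<mu> N \<le> 1 - measure \<mu> (arc p q)"
      using concentrated_nearest[OF \<mu> assms(2)] by blast
    have "1 - measure (\<phi> \<mu>) (arc p' q') \<le> kuiper (\<phi> \<mu>) (\<phi> N)"
      using N pq b(2)[OF \<mu>] by (intro kuiper_ge_concentrated) auto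
    then show "measure \<mu> (arc p q) \<le> measure (\<phi> \<mu>) (arc p' q')"
      using N b(4)[OF \<mu>, of N] by (simp add: concentrated_def)
    obtain N' where N': "N' \<in> concentrated p' q'" "kuiper (\<phi> \<mu>) N' \<le> 1 - measure (\<phi> \<mu>) (arc p' q')"
      using concentrated_nearest[OF b(2)[OF \<mu>] pq(1)] by blast
    obtain N where N: "N \<in> concentrated p q" "N' = \<phi> N" using pq N'(1) by blast
    have "1 - measure \<mu> (arc p q) \<le> kuiper \<mu> N"
      using N \<mu> by (intro kuiper_ge_concentrated) auto
    then show "measure (\<phi> \<mu>) (arc p' q') \<le> measure \<mu> (arc p q)"
      using N N' b(4)[OF \<mu>, of N] by (simp add: concentrated_def)
  qed
  then show ?thesis using pq by blast
qed

section \<open>Endpoints of arcs\<close>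

text \<open>A Gaussian conditioned on the interval serves; what matters is only where its
  distribution function rises.\<close>

lemma uniform_on_interval:
  fixes a b :: real
  assumes "a < b"
  shows "\<exists>M\<in>Pc. (\<forall>t\<le>a. circ_cdf M (Some t) = 0) \<and> (\<forall>t\<ge>b. circ_cdf M (Some t) = 1)"
proof -
  obtain M where M: "M \<in> Pc" "measure M {a<..b} = 1"
    using full_measure_on_arc[of "Some a" "Some b"] assms by auto
  interpret real_distribution M using PcD(6)[OF M(1)] .
  have 1: "measure M {..t} = 0" if "t \<le> a" for t
  proof -
    have "measure M {..t} \<le> measure M (- {a<..b})" using that by (intro finite_measure_mono) auto
    then show ?thesis using measure_Compl_Pc[OF M(1), of "{a<..b}"] M(2) by (simp add: measure_le_0_iff)
  qed
  moreover have "measure M {..t} = 1" if "t \<ge> b" for t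
  proof -
    have "measure M {a<..b} \<le> measure M {..t}" using that by (intro finite_measure_mono) auto
    then show ?thesis using M(2) prob_le_1[of "{..t}"] by linarith
  qed
  ultimately show ?thesis using M(1) by (auto simp: circ_cdf_Some)
qed

lemma circ_cdf_bounds: "M \<in> Pc \<Longrightarrow> 0 \<le> circ_cdf M p \<and> circ_cdf M p \<le> 1"
  by (cases p) (auto simp: circ_cdf_Some intro: prob_space.prob_le_1[OF PcD(1)])

text \<open>Up to a constant, differences of distribution functions serve as nonnegative test
  functions separating a point of the circle from a finite set. The constant allows a positive value
  at infinity, where the difference itself is 0.\<close>

lemma bump:
  assumes "finite E" "q \<notin> E"
  shows "\<exists>M\<in>Pc. \<exists>N\<in>Pc. \<exists>c. (\<forall>p. 0 \<le> circ_cdf M p - circ_cdf N p + c) \<and>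
    0 < circ_cdf M q - circ_cdf N q + c \<and> (\<forall>p\<in>E. circ_cdf M p - circ_cdf N p + c = 0)"
proof (cases q)
  case None
  define R where "R = Max (insert 0 ((\<lambda>p. \<bar>the p\<bar>) ` E))"
  have R: "\<bar>the p\<bar> \<le> R" if "p \<in> E" for p unfolding R_def using assms(1) that by (intro Max_ge) auto
  \<comment> \<open>\<open>M\<close> rises to the right of \<open>R\<close> and \<open>N\<close> to
    the left of \<open>- R\<close>, so the difference is -1 on the part of the line containing
    \<open>E\<close>.\<close>
  obtain M where M: "M \<in> Pc" "\<And>t. t \<le> R \<Longrightarrow> circ_cdf M (Some t) = 0"
    using uniform_on_interval[of R "R + 1"] by auto
  obtain N where N: "N \<in> Pc" "\<And>t. t \<ge> - R \<Longrightarrow> circ_cdf N (Some t) = 1"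
    using uniform_on_interval[of "- R - 1" "- R"] by auto
  show ?thesis
  proof (rule bexI[OF _ M(1)], rule bexI[OF _ N(1)], rule exI[of _ 1], intro conjI allI ballI)
    show "0 \<le> circ_cdf M p - circ_cdf N p + 1" for p
      using circ_cdf_bounds[OF M(1), of p] circ_cdf_bounds[OF N(1), of p] by linarith
    show "0 < circ_cdf M q - circ_cdf N q + 1" using None by simp
    show "circ_cdf M p - circ_cdf N p + 1 = 0" if "p \<in> E" for p
    proof (cases p)
      case (Some t)
      then have "t \<le> R" "t \<ge> - R" using R[OF that] by auto
      then show ?thesis using M(2) N(2) Some by simp
    qed (use that assms(2) None in auto)
  qed
next
  case (Some x)
  define e where "e = Min (insert 1 ((\<lambda>p. \<bar>the p - x\<bar>) ` (E - {None})))"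
  have e: "e > 0" unfolding e_def using assms Some
    by (subst Min_gr_iff) auto
  have ed: "e \<le> \<bar>t - x\<bar>" if "Some t \<in> E" for t
    unfolding e_def using assms(1) that by (intro Min_le) (auto intro!: image_eqI[of _ _ "Some t"])
  \<comment> \<open>\<open>M\<close> rises just before \<open>x\<close> and \<open>N\<close> just
    after, so the difference is 1 at \<open>x\<close> and 0 at distance at least \<open>e\<close>
    from \<open>x\<close>, where all finite points of \<open>E\<close> lie.\<close>
  obtain M where M: "M \<in> Pc" "\<And>t. t \<le> x - e \<Longrightarrow> circ_cdf M (Some t) = 0"
    "\<And>t. t \<ge> x \<Longrightarrow> circ_cdf M (Some t) = 1"
    using uniform_on_interval[of "x - e" x] e by auto
  obtain N where N: "N \<in> Pc" "\<And>t. t \<le> x \<Longrightarrow> circ_cdf N (Some t) = 0"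
    "\<And>t. t \<ge> x + e \<Longrightarrow> circ_cdf N (Some t) = 1"
    using uniform_on_interval[of x "x + e"] e by auto
  show ?thesis
  proof (rule bexI[OF _ M(1)], rule bexI[OF _ N(1)], rule exI[of _ 0], intro conjI allI ballI)
    show "0 \<le> circ_cdf M p - circ_cdf N p + 0" for p
    proof (cases p)
      case (Some t)
      then show ?thesis
        using circ_cdf_bounds[OF M(1), of p] circ_cdf_bounds[OF N(1), of p] M(3)[of t] N(2)[of t]
        by (cases "t \<le> x") auto
    qed simp
    show "0 < circ_cdf M q - circ_cdf N q + 0" using Some M(3) N(2) by simp
    show "circ_cdf M p - circ_cdf N p + 0 = 0" if "p \<in> E" for p
    proof (cases p)
      case (Some t)
      then have "t \<le> x - e \<or> t \<ge> x + e" using ed[of t] that by (auto simp: abs_if split: if_splits)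
      then show ?thesis using Some M(2,3)[of t] N(2,3)[of t] e by auto
    qed simp
  qed
qed

text \<open>Compare the coefficients of the point masses at q and at p in the identity
  [q] - [p] = ([q1] - [p1]) + ([q2] - [p2]) of functionals on differences of distribution functions.\<close>

lemma arc_sum_endpoints:
  assumes eq: "\<And>M N. M \<in> Pc \<Longrightarrow> N \<in> Pc \<Longrightarrow>
    measure M (arc p q) - measure N (arc p q) =
    (measure M (arc p1 q1) - measure N (arc p1 q1)) + (measure M (arc p2 q2) - measure N (arc p2 q2))"
  shows "q \<in> {p, q1, q2} \<and> p \<in> {q, p1, p2}"
proof -
  have eq': "(circ_cdf M q - circ_cdf N q) - (circ_cdf M p - circ_cdf N p) =
     ((circ_cdf M q1 - circ_cdf N q1) - (circ_cdf M p1 - circ_cdf N p1)) +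
     ((circ_cdf M q2 - circ_cdf N q2) - (circ_cdf M p2 - circ_cdf N p2))"
    if "M \<in> Pc" "N \<in> Pc" for M N
    using eq[OF that] by (simp add: measure_arc[OF that(1)] measure_arc[OF that(2)])
  show ?thesis
  proof (intro conjI)
    show "q \<in> {p, q1, q2}"
    proof (rule ccontr)
      assume "q \<notin> {p, q1, q2}"
      then obtain M N c where MN: "M \<in> Pc" "N \<in> Pc" and
        c: "\<And>p. 0 \<le> circ_cdf M p - circ_cdf N p + c" "0 < circ_cdf M q - circ_cdf N q + c"
          "\<And>r. r \<in> {p, q1, q2} \<Longrightarrow> circ_cdf M r - circ_cdf N r + c = 0"
        using bump[of "{p, q1, q2}" q] by auto
      \<comment> \<open>The constant \<open>c\<close> cancels; the left side of the identity is
        positive and the right side is at most 0.\<close>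
      show False using eq'[OF MN] c(1)[of p1] c(1)[of p2] c(2) c(3)[of p] c(3)[of q1] c(3)[of q2]
        by simp
    qed
    show "p \<in> {q, p1, p2}"
    proof (rule ccontr)
      assume "p \<notin> {q, p1, p2}"
      then obtain M N c where MN: "M \<in> Pc" "N \<in> Pc" and
        c: "\<And>p. 0 \<le> circ_cdf M p - circ_cdf N p + c" "0 < circ_cdf M p - circ_cdf N p + c"
          "\<And>r. r \<in> {q, p1, p2} \<Longrightarrow> circ_cdf M r - circ_cdf N r + c = 0"
        using bump[of "{q, p1, p2}" p] by auto
      \<comment> \<open>Now the left side is negative and the right side is at least 0.\<close>
      show False using eq'[OF MN] c(1)[of q1] c(1)[of q2] c(2) c(3)[of q] c(3)[of p1] c(3)[of p2]
        by simp
    qed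
  qed
qed

text \<open>The second summand is taken to be an empty arc: at \<open>p\<close> it yields
  \<open>q = q'\<close>, at \<open>q\<close> it yields \<open>p = p'\<close>.\<close>

lemma arc_determined:
  assumes "p \<noteq> q" and eq: "\<And>M. M \<in> Pc \<Longrightarrow> measure M (arc p q) = measure M (arc p' q')"
  shows "p = p' \<and> q = q'"
  using arc_sum_endpoints[of p q p' q' p p] arc_sum_endpoints[of p q p' q' q q] assms by auto

text \<open>If \<open>f s\<close> and \<open>f t\<close> differ, then \<open>g s = g t\<close>, and
  any \<open>u\<close> differs under \<open>f\<close> from \<open>s\<close> or from
  \<open>t\<close>, so \<open>g u\<close> is that same value.\<close>

lemma union_of_equivalences_total:
  assumes "\<And>s t. f s = f t \<or> g s = g t"
  shows "(\<forall>s t. f s = f t) \<or> (\<forall>s t. g s = g t)"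
  by (metis assms)

lemma isometry_common_endpoint:
  assumes iso: "kuiper_isometry \<phi>"
  shows "\<exists>p k. (\<forall>t. \<forall>\<mu>\<in>Pc. measure (\<phi> \<mu>) (arc p (k t)) = measure \<mu> {..t}) \<and> (\<forall>t. k t \<noteq> p) \<or>
    (\<forall>t. \<forall>\<mu>\<in>Pc. measure (\<phi> \<mu>) (arc (k t) p) = measure \<mu> {..t}) \<and> (\<forall>t. k t \<noteq> p)"
proof -
  have "\<exists>p q. p \<noteq> q \<and> (\<forall>\<mu>\<in>Pc. measure (\<phi> \<mu>) (arc p q) = measure \<mu> {..t})" for t
    using isometry_arc[OF iso, of None "Some t"] by simp
  then obtain P Q where PQ: "\<And>t. P t \<noteq> Q t"
    "\<And>t \<mu>. \<mu> \<in> Pc \<Longrightarrow> measure (\<phi> \<mu>) (arc (P t) (Q t)) = measure \<mu> {..t}"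
    by metis
  have lt: "P s = P t \<or> Q s = Q t" if "s < t" for s t
  proof -
    obtain p q where pq: "p \<noteq> q" "\<And>\<mu>. \<mu> \<in> Pc \<Longrightarrow> measure (\<phi> \<mu>) (arc p q) = measure \<mu> {s<..t}"
      using isometry_arc[OF iso, of "Some s" "Some t"] \<open>s < t\<close> by auto
    have sum: "measure M (arc (P t) (Q t)) = measure M (arc (P s) (Q s)) + measure M (arc p q)"
      if M: "M \<in> Pc" for M
    proof -
      obtain \<mu> where \<mu>: "M = \<phi> \<mu>" "\<mu> \<in> Pc" using kuiper_isometryD(1)[OF iso] M by blast
      have "measure \<mu> {..t} = measure \<mu> {..s} + measure \<mu> {s<..t}"
        using measure_arc[OF \<mu>(2), of "Some s" "Some t"] \<open>s < t\<close> by (simp add: circ_cdf_Some)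
      then show ?thesis using \<mu> PQ(2) pq(2) by simp
    qed
    have "Q t \<in> {P t, Q s, q} \<and> P t \<in> {Q t, P s, p}"
      by (rule arc_sum_endpoints) (simp add: sum)
    moreover have "\<not> (Q t = q \<and> P t = p)"
    proof
      assume *: "Q t = q \<and> P t = p"
      have "measure M (arc (P s) (Q s)) = 0" if "M \<in> Pc" for M using sum[OF that] * by simp
      \<comment> \<open>If the arc for \<open>{..t}\<close> were the one for \<open>{s<..t}\<close>,
        nothing would be left for \<open>{..s}\<close>; yet a nondegenerate arc carries some
        measure.\<close>
      moreover have "\<exists>M\<in>Pc. measure M (arc (P s) (Q s)) = 1" using full_measure_on_arc[OF PQ(1)[of s]] by auto
      ultimately show False by force
    qed
    ultimately show ?thesis using PQ(1)[of t] by auto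
  qed
  have "P s = P t \<or> Q s = Q t" for s t
    using lt[of s t] lt[of t s] by (cases s t rule: linorder_cases) auto
  then consider "\<And>s t. P s = P t" | "\<And>s t. Q s = Q t"
    using union_of_equivalences_total[of P Q] by auto
  then show ?thesis
  proof cases
    case 1
    then have "P t = P 0" for t by blast
    then show ?thesis using PQ by (intro exI[of _ "P 0"] exI[of _ Q]) metis
  next
    case 2
    then have "Q t = Q 0" for t by blast
    then show ?thesis using PQ by (intro exI[of _ "Q 0"] exI[of _ P]) metis
  qed
qed

section \<open>Transformations induced by homeomorphisms of the circle\<close>

lemma distr_Pc:
  assumes "M \<in> Pc" "H \<in> borel_measurable borel" "inj H"
  shows "distr M borel H \<in> Pc"
proof -
  interpret real_distribution M using PcD(6)[OF assms(1)] .
  have "emeasure (distr M borel H) {t} = 0" for t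
  proof (cases "t \<in> range H")
    case True
    then obtain s where "t = H s" by auto
    then have "H -` {t} = {s}" using assms(3) by (auto dest: injD)
    then show ?thesis using PcD(4)[OF assms(1), of s] assms(2) by (subst emeasure_distr) auto
  next
    case False
    then have "H -` {t} = {}" by auto
    then show ?thesis using assms(2) by (subst emeasure_distr) auto
  qed
  moreover have "prob_space (distr M borel H)" using assms(2) by (intro prob_space_distr) simp
  ultimately show ?thesis by (simp add: Pc_def)
qed

lemma measure_distr_Pc:
  assumes "M \<in> Pc" "H \<in> borel_measurable borel" "A \<in> sets borel"
  shows "measure (distr M borel H) A = measure M (H -` A)"
proof -
  interpret real_distribution M using PcD(6)[OF assms(1)] .
  show ?thesis using assms(2,3) by (subst measure_distr) auto
qed

lemma distr_comp_Pc:
  assumes "M \<in> Pc" "H \<in> borel_measurable borel" "K \<in> borel_measurable borel"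
  shows "distr (distr M borel H) borel K = distr M borel (K \<circ> H)"
proof -
  interpret real_distribution M using PcD(6)[OF assms(1)] .
  show ?thesis using assms by (intro distr_distr) auto
qed

lemma distr_id_Pc: "M \<in> Pc \<Longrightarrow> distr M borel id = M"
  using distr_id2[of borel M] PcD(2)[of M] by (simp add: id_def)

text \<open>Borel bijections of the line instead of homeomorphisms of the circle, so that
  \<open>inverse\<close>, with its default value at 0, is included.\<close>

definition kuiper_map :: "(real \<Rightarrow> real) \<Rightarrow> bool" where
  "kuiper_map H \<longleftrightarrow> bij H \<and> H \<in> borel_measurable borel \<and> inv H \<in> borel_measurable borel \<and>
    (\<forall>M\<in>Pc. \<forall>N\<in>Pc. kuiper (distr M borel H) (distr N borel H) = kuiper M N)"

lemma kuiper_mapD: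
  assumes "kuiper_map H"
  shows "bij H" "inj H" "H \<in> borel_measurable borel" "inv H \<in> borel_measurable borel" "inj (inv H)"
    "M \<in> Pc \<Longrightarrow> N \<in> Pc \<Longrightarrow> kuiper (distr M borel H) (distr N borel H) = kuiper M N"
    "M \<in> Pc \<Longrightarrow> distr M borel H \<in> Pc" "M \<in> Pc \<Longrightarrow> distr M borel (inv H) \<in> Pc"
    "M \<in> Pc \<Longrightarrow> distr (distr M borel H) borel (inv H) = M"
    "M \<in> Pc \<Longrightarrow> distr (distr M borel (inv H)) borel H = M"
proof -
  show 1: "bij H" "inj H" "H \<in> borel_measurable borel" "inv H \<in> borel_measurable borel"
    "M \<in> Pc \<Longrightarrow> N \<in> Pc \<Longrightarrow> kuiper (distr M borel H) (distr N borel H) = kuiper M N"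
    using assms by (auto simp: kuiper_map_def bij_is_inj)
  show i: "inj (inv H)" using bij_imp_bij_inv[OF 1(1)] by (rule bij_is_inj)
  have c: "inv H \<circ> H = id" "H \<circ> inv H = id"
    using 1(1) surj_iff[of H] inj_iff[of H] by (auto simp: bij_def)
  assume M: "M \<in> Pc"
  show "distr M borel H \<in> Pc" "distr M borel (inv H) \<in> Pc" using distr_Pc M 1 i by auto
  show "distr (distr M borel H) borel (inv H) = M" "distr (distr M borel (inv H)) borel H = M"
    using distr_comp_Pc[OF M 1(3,4)] distr_comp_Pc[OF M 1(4,3)] distr_id_Pc[OF M] c by auto
qed

lemma kuiper_map_comp:
  assumes "kuiper_map H" "kuiper_map K"
  shows "kuiper_map (K \<circ> H)"
  unfolding kuiper_map_def
proof (intro conjI ballI)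
  note H = kuiper_mapD[OF assms(1)] and K = kuiper_mapD[OF assms(2)]
  show "bij (K \<circ> H)" using H(1) K(1) by (rule bij_comp)
  show "K \<circ> H \<in> borel_measurable borel" using H(3) K(3) by (rule measurable_comp)
  show "inv (K \<circ> H) \<in> borel_measurable borel"
    unfolding o_inv_distrib[OF K(1) H(1)] using K(4) H(4) by (rule measurable_comp)
  fix M N assume "M \<in> Pc" "N \<in> Pc"
  then show "kuiper (distr M borel (K \<circ> H)) (distr N borel (K \<circ> H)) = kuiper M N"
    using H K(6)[of "distr M borel H" "distr N borel H"] by (simp add: distr_comp_Pc[symmetric] H(3) K(3))
qed

lemma kuiper_map_inv:
  assumes "kuiper_map H"
  shows "kuiper_map (inv H)"
  unfolding kuiper_map_def
proof (intro conjI ballI)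
  note H = kuiper_mapD[OF assms]
  show "bij (inv H)" using H(1) by (rule bij_imp_bij_inv)
  show "inv H \<in> borel_measurable borel" "inv (inv H) \<in> borel_measurable borel"
    using H by (auto simp: inv_inv_eq)
  fix M N assume "M \<in> Pc" "N \<in> Pc"
  then show "kuiper (distr M borel (inv H)) (distr N borel (inv H)) = kuiper M N"
    using H(6)[of "distr M borel (inv H)" "distr N borel (inv H)"] H(8,10) by simp
qed

lemma kuiper_isometry_distr:
  assumes "kuiper_map H"
  shows "kuiper_isometry (\<lambda>M. distr M borel H)"
proof -
  note H = kuiper_mapD[OF assms]
  have "M \<in> (\<lambda>M. distr M borel H) ` Pc" if "M \<in> Pc" for M
    using H(8,10)[OF that] by (metis imageI)
  then show ?thesis using H(6,7) by (auto simp: kuiper_isometry_def)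
qed

text \<open>A map of the circle that moves the point at infinity changes the base point r at which
  distribution functions are normalised to 0; \<open>\<epsilon>\<close> is its orientation, and \<open>\<kappa>\<close> cancels in
  differences of measures.\<close>

lemma kuiper_distr_le:
  assumes H: "H \<in> borel_measurable borel" "inj H" and \<epsilon>: "\<epsilon> = 1 \<or> \<epsilon> = -1"
    and cdf: "\<And>M p. M \<in> Pc \<Longrightarrow> circ_cdf (distr M borel H) p = circ_cdf M r + \<epsilon> * circ_cdf M (\<sigma> p) + \<kappa> p"
    and MN: "M \<in> Pc" "N \<in> Pc"
  shows "kuiper (distr M borel H) (distr N borel H) \<le> kuiper M N"
proof -
  let ?M = "distr M borel H" and ?N = "distr N borel H"
  obtain p q where pq: "kuiper ?M ?N = (circ_cdf ?M q - circ_cdf ?N q) - (circ_cdf ?M p - circ_cdf ?N p)"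
    using kuiper_attained[OF distr_Pc[OF MN(1) H] distr_Pc[OF MN(2) H]] by blast
  \<comment> \<open>The terms with \<open>r\<close> and \<kappa> cancel; \<epsilon> = -1 exchanges
    the roles of \<open>p\<close> and \<open>q\<close>.\<close>
  show ?thesis
    unfolding pq cdf[OF MN(1)] cdf[OF MN(2)]
    using kuiper_ge_circ_cdf[OF MN, of "\<sigma> q" "\<sigma> p"] kuiper_ge_circ_cdf[OF MN, of "\<sigma> p" "\<sigma> q"] \<epsilon>
    by auto
qed

lemma kuiper_mapI:
  assumes "bij H" "H \<in> borel_measurable borel" "inv H \<in> borel_measurable borel"
    and le: "\<And>M N. M \<in> Pc \<Longrightarrow> N \<in> Pc \<Longrightarrow> kuiper (distr M borel H) (distr N borel H) \<le> kuiper M N"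
    and le': "\<And>M N. M \<in> Pc \<Longrightarrow> N \<in> Pc \<Longrightarrow> kuiper (distr M borel (inv H)) (distr N borel (inv H)) \<le> kuiper M N"
  shows "kuiper_map H"
  unfolding kuiper_map_def
proof (intro conjI ballI antisym)
  fix M N assume MN: "M \<in> Pc" "N \<in> Pc"
  have "distr (distr M borel H) borel (inv H) = M" if "M \<in> Pc" for M
    using distr_comp_Pc[OF that assms(2,3)] distr_id_Pc[OF that] bij_is_inj[OF assms(1)] by simp
  then show "kuiper M N \<le> kuiper (distr M borel H) (distr N borel H)"
    using le'[of "distr M borel H" "distr N borel H"] MN distr_Pc assms(2) bij_is_inj[OF assms(1)] by simp
qed (use assms in auto)

lemma strict_mono_bij_continuous:
  fixes k :: "real \<Rightarrow> real"
  assumes "strict_mono k" "bij k"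
  shows "continuous_on UNIV k" "strict_mono (inv k)"
proof -
  show "continuous_on UNIV k"
    using assms by (intro continuous_onI_mono) (auto simp: bij_def strict_mono_less_eq)
  show "strict_mono (inv k)"
    using assms by (intro strict_monoI) (metis bij_inv_eq_iff strict_mono_less)
qed

lemma kuiper_map_strict_mono:
  assumes "strict_mono k" "bij k"
  shows "kuiper_map k"
proof -
  have m: "k \<in> borel_measurable borel" if "strict_mono k" for k :: "real \<Rightarrow> real"
    using that by (intro borel_measurable_mono) (simp add: strict_mono_mono)
  have le: "kuiper (distr M borel k) (distr N borel k) \<le> kuiper M N"
    if k: "strict_mono k" "bij k" and MN: "M \<in> Pc" "N \<in> Pc" for k M N
  proof (rule kuiper_distr_le[where \<epsilon>=1 and r=None and \<sigma>="map_option (inv k)" and \<kappa>="\<lambda>_. 0"])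
    fix M :: "real measure" and p assume M: "M \<in> Pc"
    have "k -` {..t} = {..inv k t}" for t
      using strict_mono_less_eq[OF k(1), of _ "inv k t"] surj_f_inv_f[OF bij_is_surj[OF k(2)], of t] by auto
    then show "circ_cdf (distr M borel k) p = circ_cdf M None + 1 * circ_cdf M (map_option (inv k) p) + 0"
      using measure_distr_Pc[OF M m[OF k(1)]] by (cases p) (auto simp: circ_cdf_Some)
  qed (use k MN m bij_is_inj in auto)
  show ?thesis
    using m le assms strict_mono_bij_continuous(2)[OF assms] bij_imp_bij_inv[OF assms(2)]
    by (intro kuiper_mapI) auto
qed

text \<open>An involution is its own inverse, so one inequality covers both directions.\<close>

lemma kuiper_map_involution:
  assumes H: "\<And>x. H (H x) = x" "H \<in> borel_measurable borel" and \<epsilon>: "\<epsilon> = 1 \<or> \<epsilon> = -1"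
    and cdf: "\<And>M p. M \<in> Pc \<Longrightarrow> circ_cdf (distr M borel H) p = circ_cdf M r + \<epsilon> * circ_cdf M (\<sigma> p) + \<kappa> p"
  shows "kuiper_map H"
proof -
  have "H \<circ> H = id" using H(1) by auto
  then have "bij H" "inv H = H" using o_bij[of H H] inv_unique_comp[of H H] by auto
  then show ?thesis
    using kuiper_distr_le[OF H(2) bij_is_inj \<epsilon> cdf] H(2) by (intro kuiper_mapI) auto
qed

section \<open>Reflection, inversion and homeomorphisms of the line\<close>

lemma kuiper_map_uminus: "kuiper_map uminus"
\<comment> \<open>Reflection fixes infinity and reverses orientation; the 1 in \<kappa> comes from
  passing to the complementary half-line.\<close>
proof (rule kuiper_map_involution[where \<epsilon>="-1" and r=None and \<sigma>="map_option uminus" and \<kappa>="case_option 0 (\<lambda>_. 1)"])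
  fix M :: "real measure" and p assume M: "M \<in> Pc"
  show "circ_cdf (distr M borel uminus) p =
    circ_cdf M None + - 1 * circ_cdf M (map_option uminus p) + case_option 0 (\<lambda>_. 1) p"
  proof (cases p)
    case (Some t)
    have "measure (distr M borel uminus) {..t} = measure M (uminus -` {..t})"
      using M by (intro measure_distr_Pc) auto
    also have "uminus -` {..t} = {- t..}" by auto
    also have "measure M {- t..} = measure M (arc (Some (- t)) None)"
      by (rule measure_eq_upto_finite[OF M, of _ _ "{- t}"]) auto
    finally show ?thesis using Some measure_arc[OF M, of "Some (- t)" None] by (simp add: circ_cdf_Some)
  qed simp
qed auto

text \<open>Inversion exchanges 0 and infinity and reverses orientation, so the arc from infinity to
  \<open>t\<close> pulls back to the arc from \<open>1 / t\<close> to 0. The default value at 0 and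
  the endpoints are excluded.\<close>

lemma inverse_le_iff_arc:
  fixes t :: real
  defines "q \<equiv> (if t = 0 then None else Some (inverse t))"
  shows "inverse -` {..t} \<subseteq> arc q (Some 0) \<union> {0, inverse t}"
    and "arc q (Some 0) \<subseteq> inverse -` {..t} \<union> {0, inverse t}"
proof -
  have "s \<in> arc q (Some 0) \<longleftrightarrow> inverse s \<le> t" if s: "s \<noteq> 0" "s \<noteq> inverse t" for s
  proof (cases "t = 0")
    case False
    define u where "u = inverse t"
    have u: "u \<noteq> 0" "s \<noteq> u" "q = Some u" using s False by (auto simp: u_def q_def)
    have "inverse s \<le> t \<longleftrightarrow> (if 0 < s * u then u \<le> s else s \<le> u)"
      using inverse_le_iff[of s u] by (simp add: u_def)
    also have "\<dots> \<longleftrightarrow> s \<in> arc q (Some 0)"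
      using u s by (cases "u < 0"; cases "s < 0") (auto simp: zero_less_mult_iff)
    finally show ?thesis ..
  qed (use s in \<open>simp add: q_def\<close>)
  then show "inverse -` {..t} \<subseteq> arc q (Some 0) \<union> {0, inverse t}"
    and "arc q (Some 0) \<subseteq> inverse -` {..t} \<union> {0, inverse t}" by auto
qed

lemma kuiper_map_inverse: "kuiper_map inverse"
\<comment> \<open>Infinity goes to 0, hence the base point \<open>Some 0\<close>; \<kappa> is 1
  exactly when the pulled-back arc contains infinity.\<close>
proof (rule kuiper_map_involution[where \<epsilon>="-1" and r="Some 0"
      and \<sigma>="case_option (Some 0) (\<lambda>t. if t = 0 then None else Some (inverse t))" and \<kappa>="case_option 0 (\<lambda>t. of_bool (t > 0))"])
  fix M :: "real measure" and p assume M: "M \<in> Pc"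
  show "circ_cdf (distr M borel inverse) p = circ_cdf M (Some 0) +
    - 1 * circ_cdf M (case_option (Some 0) (\<lambda>t. if t = 0 then None else Some (inverse t)) p) +
    case_option 0 (\<lambda>t. of_bool (t > 0)) p"
  proof (cases p)
    case (Some t)
    let ?q = "if t = 0 then None else Some (inverse t)"
    have v: "inverse -` {..t} \<in> sets borel"
      using measurable_sets[of "inverse :: real \<Rightarrow> real" borel borel "{..t}"] by simp
    have "measure (distr M borel inverse) {..t} = measure M (inverse -` {..t})"
      using M by (intro measure_distr_Pc) auto
    also have "\<dots> = measure M (arc ?q (Some 0))"
      by (rule measure_eq_upto_finite[OF M _ _ _ inverse_le_iff_arc]) (use v in auto)
    finally show ?thesis
      using Some measure_arc[OF M, of ?q "Some 0"] by (cases "t = 0") (auto simp: circ_cdf_Some)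
  qed simp
qed auto

text \<open>The junk value 1 / 0 = 0 makes \<^term>\<open>r_map (Some a)\<close> a bijection of the whole line; the
  point a omitted by the domain of r is a null set.\<close>

lemma kuiper_map_r_map: "kuiper_map (r_map x)"
proof (cases x)
  case None
  then show ?thesis using kuiper_map_strict_mono[of id] by (simp add: r_map_def strict_mono_def)
next
  case (Some a)
  have "bij (\<lambda>t. t - a)" by (rule o_bij[of "\<lambda>t. t + a"]) auto
  then have "kuiper_map (inverse \<circ> (\<lambda>t. t - a))"
    by (intro kuiper_map_comp kuiper_map_inverse kuiper_map_strict_mono) (auto simp: strict_mono_def)
  then show ?thesis using Some by (simp add: r_map_def comp_def divide_inverse)
qed

text \<open>A continuous injection of the line is monotone; the decreasing case reduces to the
  increasing one by a reflection.\<close>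

lemma kuiper_map_homeomorphism:
  assumes "homeomorphism UNIV UNIV g h"
  shows "kuiper_map g"
proof -
  have g: "bij g" "continuous_on UNIV g"
    using assms by (auto simp: homeomorphism_def intro!: o_bij[of h g])
  then have "strict_mono g \<or> strict_antimono_on UNIV g"
    using injective_eq_monotone_map[of UNIV g] by (simp add: bij_is_inj)
  then show ?thesis
  proof
    assume "strict_antimono_on UNIV g"
    then have "strict_mono (uminus \<circ> g)" by (auto simp: monotone_on_def)
    moreover have "bij (uminus \<circ> g)" using g(1) kuiper_mapD(1)[OF kuiper_map_uminus] by (rule bij_comp)
    ultimately have "kuiper_map (uminus \<circ> (uminus \<circ> g))"
      by (intro kuiper_map_comp kuiper_map_uminus kuiper_map_strict_mono)
    then show ?thesis by (simp add: comp_def)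
  qed (use g kuiper_map_strict_mono in blast)
qed

text \<open>Images under \<open>G\<close> are preimages under \<open>inv G\<close>, and cutting down
  to \<open>A\<close> loses only a finite set, which is null.\<close>

lemma meas_comp_eq_distr:
  assumes M: "M \<in> Pc" and G: "kuiper_map G" and A: "finite (- A)"
  shows "meas_comp M G A = distr M borel (inv G)"
proof -
  interpret real_distribution M using PcD(6)[OF M] .
  have sp: "space M = UNIV" "sets M = sets borel" using PcD[OF M] by auto
  have A': "A \<in> sets borel" using A by (metis borel_closed borel_comp double_complement finite_imp_closed)
  have im: "G ` B = inv G -` B" for B
    using bij_vimage_eq_inv_image[OF bij_imp_bij_inv[OF kuiper_mapD(1)[OF G]], of B]
    by (simp add: inv_inv_eq kuiper_mapD(1)[OF G])
  have vm: "inv G -` B \<in> sets borel" if "B \<in> sets borel" for B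
    using measurable_sets[OF kuiper_mapD(4)[OF G] that] by simp
  have "emeasure M (G ` (B \<inter> A)) = emeasure M (inv G -` B \<inter> space M)" if "B \<in> sets borel" for B
  proof -
    have "measure M (G ` (B \<inter> A)) = measure M (inv G -` B)"
    proof (rule measure_eq_upto_finite[OF M])
      show "G ` (B \<inter> A) \<in> sets borel" unfolding im by (intro vm) (use that A' in auto)
      show "inv G -` B \<subseteq> G ` (B \<inter> A) \<union> G ` (- A)" unfolding im[symmetric] by auto
      show "G ` (B \<inter> A) \<subseteq> inv G -` B \<union> G ` (- A)" unfolding im[symmetric] by auto
    qed (use that vm A in auto)
    then show ?thesis using sp by (simp add: emeasure_eq_measure)
  qed
  then show ?thesis
    unfolding meas_comp_def distr_def space_borel
    by (intro measure_of_eq) (auto simp: sets.sigma_sets_eq[of borel, simplified])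
qed

section \<open>The form of surjective isometries\<close>

lemma meas_comp_homeomorphism:
  assumes g: "homeomorphism UNIV UNIV g h" and M: "M \<in> Pc"
  shows "meas_comp M (g \<circ> r_map x) (r_dom x) = distr M borel (inv (g \<circ> r_map x))"
  using M
proof (rule meas_comp_eq_distr)
  show "kuiper_map (g \<circ> r_map x)"
    using kuiper_map_r_map kuiper_map_homeomorphism[OF g] by (rule kuiper_map_comp)
  show "finite (- r_dom x)" by (cases x) (auto simp: r_dom_def)
qed

text \<open>The map r_p sends the arcs starting at p to the half-lines of one fixed orientation.\<close>

lemma r_map_arc_None:
  assumes M: "M \<in> Pc"
  shows "measure (distr M borel (r_map None)) {..u} = measure M (arc None (Some u))"
  using distr_id_Pc[OF M] by (simp add: r_map_def)

lemma r_map_arc_Some: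
  assumes M: "M \<in> Pc" and "u \<noteq> Some a"
  shows "measure (distr M borel (r_map (Some a))) {(case u of None \<Rightarrow> 0 | Some v \<Rightarrow> inverse (v - a))<..} =
    measure M (arc (Some a) u)" (is "measure _ {?s<..} = _")
proof -
  have r: "r_map (Some a) \<in> borel_measurable borel" using kuiper_mapD(3)[OF kuiper_map_r_map] .
  have "measure (distr M borel (r_map (Some a))) {?s<..} = measure M (r_map (Some a) -` {?s<..})"
    using measure_distr_Pc[OF M r, of "{?s<..}"] by simp
  also have "\<dots> = measure M (arc (Some a) u)"
  \<comment> \<open>At \<open>a\<close> the default value 0 is taken. The other point is the
    endpoint \<open>v\<close> if \<open>u = Some v\<close>, and \<open>a\<close> again if
    \<open>u\<close> is \<open>None\<close>.\<close>
  proof (rule measure_eq_upto_finite[OF M, of _ _ "{a, a + inverse ?s}"])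
    show "r_map (Some a) -` {?s<..} \<in> sets borel"
      using measurable_sets[OF r, of "{?s<..}"] by simp
    have *: "t \<in> arc (Some a) u \<longleftrightarrow> r_map (Some a) t > ?s" if t: "t \<noteq> a" "t \<noteq> a + inverse ?s" for t
    proof (cases u)
      case None
      then show ?thesis using t by (simp add: r_map_def)
    next
      case (Some v)
      define w where "w = v - a"
      define s where "s = t - a"
      have ws: "w \<noteq> 0" "s \<noteq> 0" "s \<noteq> w" using Some assms(2) t by (auto simp: w_def s_def)
      have "r_map (Some a) t > ?s \<longleftrightarrow> inverse w < inverse s"
        using Some by (simp add: r_map_def w_def s_def divide_inverse)
      also have "\<dots> \<longleftrightarrow> (if 0 < w * s then s < w else w < s)" using ws inverse_le_iff[of s w]
        by (cases "0 < w * s") (simp_all add: not_le[symmetric] mult.commute del: not_le)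
      also have "\<dots> \<longleftrightarrow> (if 0 \<le> w then 0 < s \<and> s \<le> w else \<not> (w < s \<and> s \<le> 0))"
        using ws by (cases "w < 0"; cases "s < 0") (auto simp: zero_less_mult_iff)
      also have "\<dots> \<longleftrightarrow> t \<in> arc (Some a) u" by (auto simp: Some w_def s_def)
      finally show ?thesis ..
    qed
    then show "r_map (Some a) -` {?s<..} \<subseteq> arc (Some a) u \<union> {a, a + inverse ?s}"
      "arc (Some a) u \<subseteq> r_map (Some a) -` {?s<..} \<union> {a, a + inverse ?s}" by auto
  qed simp_all
  finally show ?thesis .
qed

lemma measure_distr_uminus:
  assumes "M \<in> Pc"
  shows "measure (distr M borel uminus) {..- s} = measure M {s<..}"
proof -
  have "measure (distr M borel uminus) {..- s} = measure M (uminus -` {..- s})"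
    using assms by (intro measure_distr_Pc) auto
  also have "uminus -` {..- s} = {s..}" by auto
  also have "measure M {s..} = measure M {s<..}"
    by (rule measure_eq_upto_finite[OF assms, of _ _ "{s}"]) auto
  finally show ?thesis .
qed

lemma isometry_normal_form:
  assumes iso: "kuiper_isometry \<phi>"
  shows "\<exists>x e \<kappa>. (e = id \<or> e = uminus) \<and>
    (\<forall>t. \<forall>\<mu>\<in>Pc. measure (distr (\<phi> \<mu>) borel (e \<circ> r_map x)) {..\<kappa> t} = measure \<mu> {..t})"
proof -
  \<comment> \<open>The flag \<open>b\<close> tells whether the arcs start or end at
    \<open>p\<close>.\<close>
  obtain p k b where k: "\<And>t. k t \<noteq> p" and
    arcs: "\<And>t \<mu>. \<mu> \<in> Pc \<Longrightarrow> measure (\<phi> \<mu>) (if b then arc p (k t) else arc (k t) p) = measure \<mu> {..t}"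
  proof -
    from isometry_common_endpoint[OF iso] obtain p k where
      "(\<forall>t. \<forall>\<mu>\<in>Pc. measure (\<phi> \<mu>) (arc p (k t)) = measure \<mu> {..t}) \<and> (\<forall>t. k t \<noteq> p) \<or>
       (\<forall>t. \<forall>\<mu>\<in>Pc. measure (\<phi> \<mu>) (arc (k t) p) = measure \<mu> {..t}) \<and> (\<forall>t. k t \<noteq> p)" by blast
    then show thesis using that[of k p True] that[of k p False] by auto
  qed
  let ?T = "\<lambda>M. distr M borel (r_map p)"
  have T: "?T M \<in> Pc" if "M \<in> Pc" for M using kuiper_mapD(7)[OF kuiper_map_r_map that] .
  \<comment> \<open>The flag \<open>c\<close> tells whether arcs starting at \<open>p\<close> become
    lower or upper half-lines.\<close>
  have half: "\<exists>c. \<forall>s. \<exists>u. \<forall>M\<in>Pc. measure (?T M) (if c then {..u} else {u<..}) = measure M (arc p (k s))"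
  proof (cases p)
    case None
    then have "\<exists>u. k s = Some u" for s using k[of s] by auto
    then show ?thesis using None r_map_arc_None by (intro exI[of _ True]) metis
  next
    case (Some a)
    then show ?thesis using r_map_arc_Some[of _ "k _" a] k
      by (intro exI[of _ False] allI exI ballI) auto
  qed
  then obtain c \<kappa> where c: "\<And>s M. M \<in> Pc \<Longrightarrow>
      measure (?T M) (if c then {..\<kappa> s} else {\<kappa> s<..}) = measure M (arc p (k s))" by metis
  \<comment> \<open>Arcs ending at \<open>p\<close> are complements of arcs starting there, so lower
    half-lines result exactly when the two flags agree.\<close>
  have "measure (?T (\<phi> \<mu>)) (if b = c then {..\<kappa> t} else {\<kappa> t<..}) = measure \<mu> {..t}" if "\<mu> \<in> Pc" for t \<mu>
  proof -
    have \<phi>: "\<phi> \<mu> \<in> Pc" using kuiper_isometryD(2)[OF iso that] .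
    have "measure (\<phi> \<mu>) (arc (k t) p) = 1 - measure (\<phi> \<mu>) (arc p (k t))"
      using measure_Compl_Pc[OF \<phi>, of "arc p (k t)"] Compl_arc[of p "k t"] k[of t] by simp
    moreover have "measure (?T (\<phi> \<mu>)) {\<kappa> t<..} = 1 - measure (?T (\<phi> \<mu>)) {..\<kappa> t}"
      using measure_Compl_Pc[OF T[OF \<phi>], of "{..\<kappa> t}"] by (simp add: Compl_atMost)
    ultimately show ?thesis using c[OF \<phi>, of t] arcs[OF that, of t] by (auto split: if_splits)
  qed
  note main = this
  show ?thesis
  proof (cases "b = c")
    case True
    then show ?thesis using main by (intro exI[of _ p] exI[of _ id] exI[of _ \<kappa>]) simp
  next
    case False
    have "measure (distr (\<phi> \<mu>) borel (uminus \<circ> r_map p)) {..- \<kappa> t} = measure \<mu> {..t}" if "\<mu> \<in> Pc" for t \<mu>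
    proof -
      have \<phi>: "\<phi> \<mu> \<in> Pc" using kuiper_isometryD(2)[OF iso that] .
      have "distr (\<phi> \<mu>) borel (uminus \<circ> r_map p) = distr (?T (\<phi> \<mu>)) borel uminus"
        using distr_comp_Pc[OF \<phi> kuiper_mapD(3)[OF kuiper_map_r_map], of uminus] by simp
      then show ?thesis using measure_distr_uminus[OF T[OF \<phi>]] main[OF that] False by simp
    qed
    then show ?thesis by (intro exI[of _ p] exI[of _ uminus] exI[of _ "\<lambda>t. - \<kappa> t"]) simp
  qed
qed

text \<open>Surjectivity comes from the inverse isometry: it must send every half-line to a
  half-line \<open>{..t}\<close>, whose image under the original isometry is
  \<open>{..\<kappa> t}\<close>.\<close>

lemma isometry_halflines_bij:
  assumes iso: "kuiper_isometry \<psi>"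
    and \<kappa>: "\<And>t \<mu>. \<mu> \<in> Pc \<Longrightarrow> measure (\<psi> \<mu>) {..\<kappa> t} = measure \<mu> {..t}"
  shows "strict_mono \<kappa>" "bij \<kappa>"
proof -
  show mono: "strict_mono \<kappa>"
  proof (rule strict_monoI, rule ccontr)
    fix s t :: real assume "s < t" "\<not> \<kappa> s < \<kappa> t"
    obtain M where M: "M \<in> Pc" "measure M {s<..t} = 1"
      using full_measure_on_arc[of "Some s" "Some t"] \<open>s < t\<close> by auto
    interpret real_distribution "\<psi> M" using PcD(6)[OF kuiper_isometryD(2)[OF iso M(1)]] .
    have "measure (\<psi> M) {..\<kappa> t} \<le> measure (\<psi> M) {..\<kappa> s}"
      using \<open>\<not> \<kappa> s < \<kappa> t\<close> by (intro finite_measure_mono) auto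
    then have "measure M {..t} \<le> measure M {..s}" using \<kappa>[OF M(1)] by simp
    then show False
      using measure_arc[OF M(1), of "Some s" "Some t"] M(2) \<open>s < t\<close> by (simp add: circ_cdf_Some)
  qed
  let ?\<theta> = "inv_into Pc \<psi>"
  have \<theta>: "?\<theta> (\<psi> \<mu>) = \<mu>" "\<psi> \<mu> \<in> Pc" if "\<mu> \<in> Pc" for \<mu>
    using kuiper_isometryD(2,3)[OF iso] that by (auto simp: bij_betw_def)
  from isometry_common_endpoint[OF kuiper_isometry_inv[OF iso]] obtain p k where
    "(\<forall>u. \<forall>\<nu>\<in>Pc. measure (?\<theta> \<nu>) (arc p (k u)) = measure \<nu> {..u}) \<and> (\<forall>u. k u \<noteq> p) \<or>
     (\<forall>u. \<forall>\<nu>\<in>Pc. measure (?\<theta> \<nu>) (arc (k u) p) = measure \<nu> {..u}) \<and> (\<forall>u. k u \<noteq> p)" by blast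
  then have "surj \<kappa>"
  proof (elim disjE conjE)
    assume k: "\<forall>u. \<forall>\<nu>\<in>Pc. measure (?\<theta> \<nu>) (arc p (k u)) = measure \<nu> {..u}" "\<forall>u. k u \<noteq> p"
    have eq: "measure \<mu> (arc p (k u)) = measure (\<psi> \<mu>) {..u}" if "\<mu> \<in> Pc" for \<mu> u
      using k(1) \<theta>[OF that] by metis
    \<comment> \<open>The half-line \<open>{..t}\<close> and the arc obtained for
      \<open>{..\<kappa> t}\<close> have equal mass under every measure, so they have the same
      endpoints.\<close>
    have "None = p \<and> Some t = k (\<kappa> t)" for t
      by (rule arc_determined) (simp_all add: eq \<kappa>)
    then have p: "p = None" by simp
    have "u \<in> range \<kappa>" for u
    proof -
      obtain t where t: "k u = Some t" using k(2) p by (metis not_None_eq)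
      have "measure M (arc None (Some u)) = measure M (arc None (Some (\<kappa> t)))" if M: "M \<in> Pc" for M
      proof -
        obtain \<mu> where \<mu>: "M = \<psi> \<mu>" "\<mu> \<in> Pc" using kuiper_isometryD(1)[OF iso] M by blast
        then show ?thesis using eq[OF \<mu>(2), of u] \<kappa>[OF \<mu>(2), of t] t p by simp
      qed
      then have "Some u = Some (\<kappa> t)" using arc_determined[of None "Some u" None "Some (\<kappa> t)"] by blast
      then show ?thesis by simp
    qed
    then show ?thesis by blast
  next
    assume k: "\<forall>u. \<forall>\<nu>\<in>Pc. measure (?\<theta> \<nu>) (arc (k u) p) = measure \<nu> {..u}"
    have eq: "measure \<mu> (arc (k u) p) = measure (\<psi> \<mu>) {..u}" if "\<mu> \<in> Pc" for \<mu> u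
      using k \<theta>[OF that] by metis
    \<comment> \<open>With the other orientation, \<open>p\<close> would have to equal
      \<open>Some t\<close> for every \<open>t\<close>.\<close>
    have "None = k (\<kappa> t) \<and> Some t = p" for t
      by (rule arc_determined) (simp_all add: eq \<kappa>)
    from this[of 0] this[of 1] show ?thesis by auto
  qed
  then show "bij \<kappa>" using strict_mono_imp_inj_on[OF mono] by (simp add: bij_def)
qed

lemma isometry_meas_comp:
  assumes iso: "kuiper_isometry \<phi>"
  shows "\<exists>g x. (\<exists>h. homeomorphism UNIV UNIV g h) \<and>
    (\<forall>\<mu>\<in>Pc. \<phi> \<mu> = meas_comp \<mu> (g \<circ> r_map x) (r_dom x))"
proof -
  obtain x e \<kappa> where e: "e = id \<or> e = uminus" and
    \<kappa>: "\<And>t \<mu>. \<mu> \<in> Pc \<Longrightarrow> measure (distr (\<phi> \<mu>) borel (e \<circ> r_map x)) {..\<kappa> t} = measure \<mu> {..t}"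
    using isometry_normal_form[OF iso] by blast
  have e': "kuiper_map e" "e \<circ> e = id" "continuous_on UNIV e"
    using e kuiper_map_uminus kuiper_map_strict_mono[of id]
    by (auto simp: strict_mono_def comp_def continuous_on_minus)
  have R: "kuiper_map (e \<circ> r_map x)" using kuiper_map_r_map e'(1) by (rule kuiper_map_comp)
  define \<psi> where "\<psi> \<mu> = distr (\<phi> \<mu>) borel (e \<circ> r_map x)" for \<mu>
  have iso': "kuiper_isometry \<psi>"
    using kuiper_isometry_comp[OF iso kuiper_isometry_distr[OF R]] by (simp add: \<psi>_def[abs_def] comp_def)
  have mono: "strict_mono \<kappa>" "bij \<kappa>"
    using isometry_halflines_bij[OF iso', of \<kappa>] \<kappa> by (auto simp: \<psi>_def)
  have inv: "strict_mono (inv \<kappa>)" "bij (inv \<kappa>)"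
    using strict_mono_bij_continuous(2)[OF mono] bij_imp_bij_inv[OF mono(2)] by auto
  have c: "\<kappa> (inv \<kappa> t) = t" "inv \<kappa> (\<kappa> t) = t" for t
    using mono(2) by (simp_all add: bij_is_surj bij_is_inj surj_f_inv_f)
  \<comment> \<open>First \<open>e\<close> corrects the orientation, then
    \<open>inv \<kappa>\<close> moves each half-line \<open>{..\<kappa> t}\<close> back to
    \<open>{..t}\<close>.\<close>
  define g where "g = inv \<kappa> \<circ> e"
  have ee: "e (e t) = t" for t using e'(2) by (metis comp_apply id_apply)
  have hom: "homeomorphism UNIV UNIV g (e \<circ> \<kappa>)"
  proof (rule homeomorphismI)
    show "continuous_on UNIV g" "continuous_on UNIV (e \<circ> \<kappa>)"
      unfolding g_def using e'(3) strict_mono_bij_continuous(1)[OF mono] strict_mono_bij_continuous(1)[OF inv]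
      by (intro continuous_on_compose; blast intro: continuous_on_subset)+
  qed (auto simp: g_def c ee)
  have "\<phi> \<mu> = meas_comp \<mu> (g \<circ> r_map x) (r_dom x)" if \<mu>: "\<mu> \<in> Pc" for \<mu>
  proof -
    let ?G = "g \<circ> r_map x"
    have \<phi>: "\<phi> \<mu> \<in> Pc" "\<psi> \<mu> \<in> Pc" using kuiper_isometryD(2)[OF iso \<mu>] kuiper_isometryD(2)[OF iso' \<mu>] by auto
    have G: "kuiper_map ?G"
      using kuiper_map_r_map kuiper_map_homeomorphism[OF hom] by (rule kuiper_map_comp)
    have K: "kuiper_map (inv \<kappa>)" using kuiper_map_strict_mono[OF inv] .
    have "distr (\<phi> \<mu>) borel ?G = distr (\<psi> \<mu>) borel (inv \<kappa>)"
      unfolding \<psi>_def using distr_comp_Pc[OF \<phi>(1) kuiper_mapD(3)[OF R] kuiper_mapD(3)[OF K]]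
      by (simp add: g_def comp_assoc)
    also have "\<dots> = \<mu>"
    proof (rule Pc_eqI)
      fix t
      have "inv \<kappa> -` {..t} = {..\<kappa> t}"
        using strict_mono_less_eq[OF mono(1), of "inv \<kappa> _" t] c(1) by auto
      then show "measure (distr (\<psi> \<mu>) borel (inv \<kappa>)) {..t} = measure \<mu> {..t}"
        using measure_distr_Pc[OF \<phi>(2) kuiper_mapD(3)[OF K], of "{..t}"] \<kappa>[OF \<mu>] by (simp add: \<psi>_def)
    qed (use \<mu> kuiper_mapD(7)[OF K \<phi>(2)] in auto)
    finally have "distr (\<phi> \<mu>) borel ?G = \<mu>" .
    then have "\<phi> \<mu> = distr \<mu> borel (inv ?G)" using kuiper_mapD(9)[OF G \<phi>(1)] by simp
    then show ?thesis using meas_comp_homeomorphism[OF hom \<mu>] by simp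
  qed
  then show ?thesis using hom by blast
qed

text \<open>These transformations are push-forwards along the inverse of a
  \<open>kuiper_map\<close>.\<close>

lemma meas_comp_isometry:
  assumes "homeomorphism UNIV UNIV g h"
  shows "kuiper_isometry (\<lambda>\<mu>. meas_comp \<mu> (g \<circ> r_map x) (r_dom x))"
proof -
  have "kuiper_map (inv (g \<circ> r_map x))"
    by (intro kuiper_map_inv kuiper_map_comp kuiper_map_r_map kuiper_map_homeomorphism[OF assms])
  then have "kuiper_isometry (\<lambda>\<mu>. distr \<mu> borel (inv (g \<circ> r_map x)))"
    by (rule kuiper_isometry_distr)
  then show ?thesis
    by (simp add: kuiper_isometry_def meas_comp_homeomorphism[OF assms] cong: image_cong)
qed

theorem theorem1p1:
  shows
  "(\<forall>\<phi> :: real measure \<Rightarrow> real measure.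
      \<phi> ` Pc = Pc \<and> (\<forall>\<mu>\<in>Pc. \<forall>\<nu>\<in>Pc. kuiper (\<phi> \<mu>) (\<phi> \<nu>) = kuiper \<mu> \<nu>) \<longrightarrow>
      (\<exists>g x. (\<exists>h. homeomorphism UNIV UNIV g h) \<and>
             (\<forall>\<mu>\<in>Pc. \<phi> \<mu> = meas_comp \<mu> (g \<circ> r_map x) (r_dom x))))
   \<and>
   (\<forall>(g :: real \<Rightarrow> real) (x :: real option).
      (\<exists>h. homeomorphism UNIV UNIV g h) \<longrightarrow>
      (\<lambda>\<mu>. meas_comp \<mu> (g \<circ> r_map x) (r_dom x)) ` Pc = Pc \<and>
      (\<forall>\<mu>\<in>Pc. \<forall>\<nu>\<in>Pc. kuiper (meas_comp \<mu> (g \<circ> r_map x) (r_dom x))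
                                 (meas_comp \<nu> (g \<circ> r_map x) (r_dom x)) = kuiper \<mu> \<nu>))"
  using isometry_meas_comp meas_comp_isometry unfolding kuiper_isometry_def by blast

end
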